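(* The categories $\mathcal{R}(\chi)$ of $\chi$-coalgebras, for $\chi$ ranging over the $0$-cells $(\mathcal{B},\chi,T,S)$ of the 2-category $\mathbf{Dist}$, define a left $\mathbf{Dist}$-module, with left actions $\rhd\colon\mathbf{Dist}(\chi,\tau)\times\mathcal{R}(\chi)\to\mathcal{R}(\tau)$ given on objects by $$(\Sigma,\sigma,\gamma)\rhd(M,\mathcal{X},\rho)=(\Sigma M,\ \mathcal{X},\ \gamma M\circ\Sigma\rho\circ\sigma M)$$ and on morphisms by $\alpha\rhd(F,\varphi)=(F,\alpha\varphi)$, where $\alpha\varphi\colon\Sigma M\Rightarrow\Sigma'M'F$ is the horizontal composite of $\alpha\colon\Sigma\Rightarrow\Sigma'$ and $\varphi\colon M\Rightarrow M'F$.
   Context: Juxtaposition is horizontal composition, $\circ$ vertical composition; the structure of any comonad is denoted $\delta$ (comultiplication), $\epsilon$ (counit). The 2-category $\mathbf{Dist}$ of comonad distributive laws in $\mathbf{Cat}$. A $0$-cell $(\mathcal{B},\chi,T,S)$ is a category $\mathcal{B}$ with comonads $T,S$ and a distributive law $\chi\colon TS\Rightarrow ST$, i.e. $S\delta\circ\chi=\chi T\circ T\chi\circ\delta S$ and $S\epsilon\circ\chi=\epsilon S$ (for $T$), $\delta T\circ\chi=S\chi\circ\chi S\circ T\delta$ and $\epsilon T\circ\chi=T\epsilon$ (for $S$). A $1$-cell $(\Sigma,\sigma,\gamma)\colon(\mathcal{B},\chi,T,S)\to(\mathcal{D},\tau,G,C)$ is a functor $\Sigma\colon\mathcal{B}\to\mathcal{D}$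 with natural transformations $\sigma\colon G\Sigma\Rightarrow\Sigma T$ and $\gamma\colon\Sigma S\Rightarrow C\Sigma$ such that $\Sigma\delta\circ\sigma=\sigma T\circ G\sigma\circ\delta\Sigma$, $\Sigma\epsilon\circ\sigma=\epsilon\Sigma$, $\delta\Sigma\circ\gamma=C\gamma\circ\gamma S\circ\Sigma\delta$, $\epsilon\Sigma\circ\gamma=\Sigma\epsilon$, and the Yang–Baxter equation $\gamma T\circ\Sigma\chi\circ\sigma S=C\sigma\circ\tau\Sigma\circ G\gamma$ holds. A $2$-cell $(\Sigma,\sigma,\gamma)\Rightarrow(\Sigma',\sigma',\gamma')$ is a natural transformation $\alpha\colon\Sigma\Rightarrow\Sigma'$ with $\alpha T\circ\sigma=\sigma'\circ G\alpha$ and $\gamma'\circ\alpha S=C\alpha\circ\gamma$. A $\chi$-coalgebra $(M,\mathcal{X},\rho)$ is a functor $M\colon\mathcal{X}\to\mathcal{B}$ from some category $\mathcal{X}$ with a natural transformation $\rho\colon TM\Rightarrow SM$ such that $\delta M\circ\rho=S\rho\circ\chi M\circ T\rho\circ\delta M$ and $\epsilon M\circ\rho=\epsilon M$. The category $\mathcal{R}(\chi)$ has all $\chi$-coalgebras ($\mathcal{X}$ varying) as objects; a morphism $(F,\varphi)\colon(M,\mathcal{X},\rho)\to(M',\mathcal{X}',\rho')$ is a functor $F\colon\mathcal{X}\to\mathcal{X}'$ with a natural transformation $\varphi\colon M\Rightarrow M'F$ such that $S\varphi\circ\rho=\rho'F\circ T\varphi$. A left module over a 2-category $\mathbf{K}$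 consists of a category $\mathcal{M}(\mathcal{A})$ for each $0$-cell $\mathcal{A}$ and functors $\rhd\colon\mathbf{K}(\mathcal{A},\mathcal{B})\times\mathcal{M}(\mathcal{A})\to\mathcal{M}(\mathcal{B})$ which are strictly associative with respect to composition of $1$-cells and $2$-cells and strictly unital (equivalently, a 2-functor $\mathbf{K}\to\mathbf{Cat}$). *)

theory Defs
  imports "HOL-Library.FuncSet"
begin

section \<open>Categories, functors, natural transformations\<close>

text \<open>
  A category has a set of objects and a set of arrows inside two arbitrary types; all operations
  are meaningful on these sets only. Functors and natural transformations are required to be
  extensional (equal to \<open>undefined\<close> outside these sets), so that equality of HOL
  functions is equality of functors and of natural transformations, as the strict laws demand.
\<close>

record ('o, 'a) cat =
  Ob :: "'o set"
  Ar :: "'a set"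
  Dom :: "'a \<Rightarrow> 'o"
  Cod :: "'a \<Rightarrow> 'o"
  Idn :: "'o \<Rightarrow> 'a"
  Cmp :: "'a \<Rightarrow> 'a \<Rightarrow> 'a"  (infixr "\<cdot>\<index>" 70)

locale category =
  fixes C :: "('o, 'a) cat" (structure)
  assumes Dom_Ob: "f \<in> Ar C \<Longrightarrow> Dom C f \<in> Ob C"
    and Cod_Ob: "f \<in> Ar C \<Longrightarrow> Cod C f \<in> Ob C"
    and Idn_Ar: "x \<in> Ob C \<Longrightarrow> Idn C x \<in> Ar C"
    and Dom_Idn: "x \<in> Ob C \<Longrightarrow> Dom C (Idn C x) = x"
    and Cod_Idn: "x \<in> Ob C \<Longrightarrow> Cod C (Idn C x) = x"
    and Cmp_Ar: "\<lbrakk>g \<in> Ar C; f \<in> Ar C; Dom C g = Cod C f\<rbrakk> \<Longrightarrow> g \<cdot> f \<in> Ar C"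
    and Dom_Cmp: "\<lbrakk>g \<in> Ar C; f \<in> Ar C; Dom C g = Cod C f\<rbrakk> \<Longrightarrow> Dom C (g \<cdot> f) = Dom C f"
    and Cod_Cmp: "\<lbrakk>g \<in> Ar C; f \<in> Ar C; Dom C g = Cod C f\<rbrakk> \<Longrightarrow> Cod C (g \<cdot> f) = Cod C g"
    and Cmp_Idn: "f \<in> Ar C \<Longrightarrow> f \<cdot> Idn C (Dom C f) = f"
    and Idn_Cmp: "f \<in> Ar C \<Longrightarrow> Idn C (Cod C f) \<cdot> f = f"
    and Cmp_assoc: "\<lbrakk>h \<in> Ar C; g \<in> Ar C; f \<in> Ar C; Dom C h = Cod C g; Dom C g = Cod C f\<rbrakk>
      \<Longrightarrow> (h \<cdot> g) \<cdot> f = h \<cdot> (g \<cdot> f)"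

record ('o, 'a, 'p, 'b) ftor =
  fob :: "'o \<Rightarrow> 'p"
  far :: "'a \<Rightarrow> 'b"

locale cat_functor = C: category C + D: category D
  for C :: "('o, 'a) cat" and D :: "('p, 'b) cat" +
  fixes F :: "('o, 'a, 'p, 'b) ftor"
  assumes fob: "fob F \<in> Ob C \<rightarrow>\<^sub>E Ob D"
    and far: "far F \<in> Ar C \<rightarrow>\<^sub>E Ar D"
    and Dom_far: "f \<in> Ar C \<Longrightarrow> Dom D (far F f) = fob F (Dom C f)"
    and Cod_far: "f \<in> Ar C \<Longrightarrow> Cod D (far F f) = fob F (Cod C f)"
    and far_Idn: "x \<in> Ob C \<Longrightarrow> far F (Idn C x) = Idn D (fob F x)"
    and far_Cmp: "\<lbrakk>g \<in> Ar C; f \<in> Ar C; Dom C g = Cod C f\<rbrakk>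
      \<Longrightarrow> far F (g \<cdot>\<^bsub>C\<^esub> f) = far F g \<cdot>\<^bsub>D\<^esub> far F f"

definition ftor_id :: "('o, 'a) cat \<Rightarrow> ('o, 'a, 'o, 'a) ftor" where
  "ftor_id C = \<lparr>fob = (\<lambda>x\<in>Ob C. x), far = (\<lambda>f\<in>Ar C. f)\<rparr>"

text \<open>In \<open>ftor_comp C G F\<close> and below, the first argument \<open>C\<close> is the domain of \<open>F\<close>.\<close>

definition ftor_comp ::
  "('o, 'a) cat \<Rightarrow> ('p, 'b, 'q, 'c) ftor \<Rightarrow> ('o, 'a, 'p, 'b) ftor \<Rightarrow> ('o, 'a, 'q, 'c) ftor"
where
  "ftor_comp C G F = \<lparr>fob = (\<lambda>x\<in>Ob C. fob G (fob F x)), far = (\<lambda>f\<in>Ar C. far G (far F f))\<rparr>"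

text \<open>
  A natural transformation is its family of components; source and target functors are given
  separately.
\<close>

locale nat_trans = F: cat_functor C D F + G: cat_functor C D G
  for C :: "('o, 'a) cat" and D :: "('p, 'b) cat" and F G +
  fixes \<alpha> :: "'o \<Rightarrow> 'b"
  assumes component: "\<alpha> \<in> Ob C \<rightarrow>\<^sub>E Ar D"
    and Dom_component: "x \<in> Ob C \<Longrightarrow> Dom D (\<alpha> x) = fob F x"
    and Cod_component: "x \<in> Ob C \<Longrightarrow> Cod D (\<alpha> x) = fob G x"
    and naturality: "f \<in> Ar C
      \<Longrightarrow> \<alpha> (Cod C f) \<cdot>\<^bsub>D\<^esub> far F f = far G f \<cdot>\<^bsub>D\<^esub> \<alpha> (Dom C f)"

definition idt :: "('o, 'a) cat \<Rightarrow> ('p, 'b) cat \<Rightarrow> ('o, 'a, 'p, 'b) ftor \<Rightarrow> 'o \<Rightarrow> 'b" where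
  "idt C D F = (\<lambda>x\<in>Ob C. Idn D (fob F x))"

definition vcomp ::
  "('o, 'a) cat \<Rightarrow> ('p, 'b) cat \<Rightarrow> ('o \<Rightarrow> 'b) \<Rightarrow> ('o \<Rightarrow> 'b) \<Rightarrow> 'o \<Rightarrow> 'b"
where
  "vcomp C D \<beta> \<alpha> = (\<lambda>x\<in>Ob C. \<beta> x \<cdot>\<^bsub>D\<^esub> \<alpha> x)"

text \<open>Whiskering: \<open>H\<alpha>\<close> is \<open>whisker_l C H \<alpha>\<close> and \<open>\<alpha>F\<close> is \<open>whisker_r C \<alpha> F\<close>.\<close>

definition whisker_l ::
  "('o, 'a) cat \<Rightarrow> ('p, 'b, 'q, 'c) ftor \<Rightarrow> ('o \<Rightarrow> 'b) \<Rightarrow> 'o \<Rightarrow> 'c"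
where
  "whisker_l C H \<alpha> = (\<lambda>x\<in>Ob C. far H (\<alpha> x))"

definition whisker_r ::
  "('o, 'a) cat \<Rightarrow> ('p \<Rightarrow> 'c) \<Rightarrow> ('o, 'a, 'p, 'b) ftor \<Rightarrow> 'o \<Rightarrow> 'c"
where
  "whisker_r C \<alpha> F = (\<lambda>x\<in>Ob C. \<alpha> (fob F x))"

text \<open>
  \<open>hcomp C E \<beta> H \<alpha> G\<close> is the horizontal composite \<open>\<beta>\<alpha> = \<beta>G \<circ> H\<alpha>\<close> of
  \<open>\<alpha> : F \<Rightarrow> G\<close>, between functors from \<open>C\<close> to \<open>D\<close>, and \<open>\<beta> : H \<Rightarrow> K\<close>,
  between functors from \<open>D\<close> to \<open>E\<close>.
\<close>

definition hcomp ::
  "('o, 'a) cat \<Rightarrow> ('q, 'c) cat \<Rightarrow> ('p \<Rightarrow> 'c) \<Rightarrow> ('p, 'b, 'q, 'c) ftor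
    \<Rightarrow> ('o \<Rightarrow> 'b) \<Rightarrow> ('o, 'a, 'p, 'b) ftor \<Rightarrow> 'o \<Rightarrow> 'c"
where
  "hcomp C E \<beta> H \<alpha> G = vcomp C E (whisker_r C \<beta> G) (whisker_l C H \<alpha>)"

definition prod_cat :: "('o, 'a) cat \<Rightarrow> ('p, 'b) cat \<Rightarrow> ('o \<times> 'p, 'a \<times> 'b) cat" where
  "prod_cat C D =
    \<lparr>Ob = Ob C \<times> Ob D, Ar = Ar C \<times> Ar D,
     Dom = map_prod (Dom C) (Dom D), Cod = map_prod (Cod C) (Cod D),
     Idn = map_prod (Idn C) (Idn D),
     Cmp = (\<lambda>(g, g') (f, f'). (g \<cdot>\<^bsub>C\<^esub> f, g' \<cdot>\<^bsub>D\<^esub> f'))\<rparr>"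

section \<open>Strict 2-categories and left modules\<close>

text \<open>\<open>HComp K A B C\<close> is the composition functor \<open>K(B, C) \<times> K(A, B) \<rightarrow> K(A, C)\<close>.\<close>

record ('z, 'f, 't) two_cat =
  Ob2 :: "'z set"
  Hom :: "'z \<Rightarrow> 'z \<Rightarrow> ('f, 't) cat"
  Unit :: "'z \<Rightarrow> 'f"
  HComp :: "'z \<Rightarrow> 'z \<Rightarrow> 'z \<Rightarrow> ('f \<times> 'f, 't \<times> 't, 'f, 't) ftor"

locale two_category =
  fixes K :: "('z, 'f, 't) two_cat"
  assumes Hom_category: "\<lbrakk>A \<in> Ob2 K; B \<in> Ob2 K\<rbrakk> \<Longrightarrow> category (Hom K A B)"
    and Unit_Ob: "A \<in> Ob2 K \<Longrightarrow> Unit K A \<in> Ob (Hom K A A)"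
    and HComp_functor: "\<lbrakk>A \<in> Ob2 K; B \<in> Ob2 K; C \<in> Ob2 K\<rbrakk>
      \<Longrightarrow> cat_functor (prod_cat (Hom K B C) (Hom K A B)) (Hom K A C) (HComp K A B C)"
    and HComp_assoc_Ob: "\<lbrakk>A \<in> Ob2 K; B \<in> Ob2 K; C \<in> Ob2 K; D \<in> Ob2 K;
        h \<in> Ob (Hom K C D); g \<in> Ob (Hom K B C); f \<in> Ob (Hom K A B)\<rbrakk>
      \<Longrightarrow> fob (HComp K A B D) (fob (HComp K B C D) (h, g), f)
        = fob (HComp K A C D) (h, fob (HComp K A B C) (g, f))"
    and HComp_assoc_Ar: "\<lbrakk>A \<in> Ob2 K; B \<in> Ob2 K; C \<in> Ob2 K; D \<in> Ob2 K;
        w \<in> Ar (Hom K C D); v \<in> Ar (Hom K B C); u \<in> Ar (Hom K A B)\<rbrakk>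
      \<Longrightarrow> far (HComp K A B D) (far (HComp K B C D) (w, v), u)
        = far (HComp K A C D) (w, far (HComp K A B C) (v, u))"
    and Unit_left_Ob: "\<lbrakk>A \<in> Ob2 K; B \<in> Ob2 K; f \<in> Ob (Hom K A B)\<rbrakk>
      \<Longrightarrow> fob (HComp K A B B) (Unit K B, f) = f"
    and Unit_left_Ar: "\<lbrakk>A \<in> Ob2 K; B \<in> Ob2 K; u \<in> Ar (Hom K A B)\<rbrakk>
      \<Longrightarrow> far (HComp K A B B) (Idn (Hom K B B) (Unit K B), u) = u"
    and Unit_right_Ob: "\<lbrakk>A \<in> Ob2 K; B \<in> Ob2 K; f \<in> Ob (Hom K A B)\<rbrakk>
      \<Longrightarrow> fob (HComp K A A B) (f, Unit K A) = f"
    and Unit_right_Ar: "\<lbrakk>A \<in> Ob2 K; B \<in> Ob2 K; u \<in> Ar (Hom K A B)\<rbrakk>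
      \<Longrightarrow> far (HComp K A A B) (u, Idn (Hom K A A) (Unit K A)) = u"

locale left_module = two_category K for K :: "('z, 'f, 't) two_cat" +
  fixes M :: "'z \<Rightarrow> ('o, 'a) cat"
    and act :: "'z \<Rightarrow> 'z \<Rightarrow> ('f \<times> 'o, 't \<times> 'a, 'o, 'a) ftor"
  assumes M_category: "A \<in> Ob2 K \<Longrightarrow> category (M A)"
    and act_functor: "\<lbrakk>A \<in> Ob2 K; B \<in> Ob2 K\<rbrakk>
      \<Longrightarrow> cat_functor (prod_cat (Hom K A B) (M A)) (M B) (act A B)"
    and act_assoc_Ob: "\<lbrakk>A \<in> Ob2 K; B \<in> Ob2 K; C \<in> Ob2 K;
        g \<in> Ob (Hom K B C); f \<in> Ob (Hom K A B); m \<in> Ob (M A)\<rbrakk>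
      \<Longrightarrow> fob (act A C) (fob (HComp K A B C) (g, f), m)
        = fob (act B C) (g, fob (act A B) (f, m))"
    and act_assoc_Ar: "\<lbrakk>A \<in> Ob2 K; B \<in> Ob2 K; C \<in> Ob2 K;
        v \<in> Ar (Hom K B C); u \<in> Ar (Hom K A B); a \<in> Ar (M A)\<rbrakk>
      \<Longrightarrow> far (act A C) (far (HComp K A B C) (v, u), a)
        = far (act B C) (v, far (act A B) (u, a))"
    and act_unit_Ob: "\<lbrakk>A \<in> Ob2 K; m \<in> Ob (M A)\<rbrakk> \<Longrightarrow> fob (act A A) (Unit K A, m) = m"
    and act_unit_Ar: "\<lbrakk>A \<in> Ob2 K; a \<in> Ar (M A)\<rbrakk>
      \<Longrightarrow> far (act A A) (Idn (Hom K A A) (Unit K A), a) = a"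

section \<open>Comonads and distributive laws\<close>

text \<open>From here on, equations between natural transformations are written componentwise.\<close>

record ('o, 'a) comon =
  Fun :: "('o, 'a, 'o, 'a) ftor"
  delt :: "'o \<Rightarrow> 'a"
  eps :: "'o \<Rightarrow> 'a"

abbreviation fun_ob :: "('o, 'a) comon \<Rightarrow> 'o \<Rightarrow> 'o" where
  "fun_ob T \<equiv> fob (Fun T)"

abbreviation fun_ar :: "('o, 'a) comon \<Rightarrow> 'a \<Rightarrow> 'a" where
  "fun_ar T \<equiv> far (Fun T)"

locale comonad =
  T: cat_functor B B "Fun T" +
  delt: nat_trans B B "Fun T" "ftor_comp B (Fun T) (Fun T)" "delt T" +
  eps: nat_trans B B "Fun T" "ftor_id B" "eps T"
  for B :: "('o, 'a) cat" and T :: "('o, 'a) comon" +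
  assumes coassoc: "x \<in> Ob B \<Longrightarrow>
      fun_ar T (delt T x) \<cdot>\<^bsub>B\<^esub> delt T x = delt T (fun_ob T x) \<cdot>\<^bsub>B\<^esub> delt T x"
    and counit_left: "x \<in> Ob B \<Longrightarrow> eps T (fun_ob T x) \<cdot>\<^bsub>B\<^esub> delt T x = Idn B (fun_ob T x)"
    and counit_right: "x \<in> Ob B \<Longrightarrow> fun_ar T (eps T x) \<cdot>\<^bsub>B\<^esub> delt T x = Idn B (fun_ob T x)"

locale distributive_law =
  T: comonad B T + S: comonad B S +
  chi: nat_trans B B "ftor_comp B (Fun T) (Fun S)" "ftor_comp B (Fun S) (Fun T)" \<chi>
  for B :: "('o, 'a) cat" and \<chi> T S +
  assumes delt_T: "x \<in> Ob B \<Longrightarrow>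
      fun_ar S (delt T x) \<cdot>\<^bsub>B\<^esub> \<chi> x
        = \<chi> (fun_ob T x) \<cdot>\<^bsub>B\<^esub> fun_ar T (\<chi> x) \<cdot>\<^bsub>B\<^esub> delt T (fun_ob S x)"
    and eps_T: "x \<in> Ob B \<Longrightarrow> fun_ar S (eps T x) \<cdot>\<^bsub>B\<^esub> \<chi> x = eps T (fun_ob S x)"
    and delt_S: "x \<in> Ob B \<Longrightarrow>
      delt S (fun_ob T x) \<cdot>\<^bsub>B\<^esub> \<chi> x
        = fun_ar S (\<chi> x) \<cdot>\<^bsub>B\<^esub> \<chi> (fun_ob S x) \<cdot>\<^bsub>B\<^esub> fun_ar T (delt S x)"
    and eps_S: "x \<in> Ob B \<Longrightarrow> eps S (fun_ob T x) \<cdot>\<^bsub>B\<^esub> \<chi> x = fun_ar T (eps S x)"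

section \<open>The 2-category of distributive laws\<close>

record ('o, 'a) zero_cell =
  base :: "('o, 'a) cat"
  law :: "'o \<Rightarrow> 'a"
  comT :: "('o, 'a) comon"
  comS :: "('o, 'a) comon"

definition is_zero_cell :: "('o, 'a) zero_cell \<Rightarrow> bool" where
  "is_zero_cell X \<longleftrightarrow> distributive_law (base X) (law X) (comT X) (comS X)"

text \<open>In \<open>(\<Sigma>, \<sigma>, \<gamma>)\<close>, \<open>\<Sigma>\<close> is \<open>carr\<close>, \<open>\<sigma>\<close> is \<open>sig\<close> and \<open>\<gamma>\<close> is \<open>gam\<close>.\<close>

record ('o, 'a) one_cell =
  carr :: "('o, 'a, 'o, 'a) ftor"
  sig :: "'o \<Rightarrow> 'a"
  gam :: "'o \<Rightarrow> 'a"

locale dist_one_cell =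
  chi: distributive_law B \<chi> T S + tau: distributive_law D \<tau> G C +
  P: cat_functor B D "carr P" +
  sig: nat_trans B D "ftor_comp B (Fun G) (carr P)" "ftor_comp B (carr P) (Fun T)" "sig P" +
  gam: nat_trans B D "ftor_comp B (carr P) (Fun S)" "ftor_comp B (Fun C) (carr P)" "gam P"
  for B :: "('o, 'a) cat" and \<chi> T S and D :: "('o, 'a) cat" and \<tau> G C
    and P :: "('o, 'a) one_cell" +
  assumes sig_delt: "x \<in> Ob B \<Longrightarrow>
      far (carr P) (delt T x) \<cdot>\<^bsub>D\<^esub> sig P x
        = sig P (fun_ob T x) \<cdot>\<^bsub>D\<^esub> fun_ar G (sig P x) \<cdot>\<^bsub>D\<^esub> delt G (fob (carr P) x)"
    and sig_eps: "x \<in> Ob B \<Longrightarrow>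
      far (carr P) (eps T x) \<cdot>\<^bsub>D\<^esub> sig P x = eps G (fob (carr P) x)"
    and gam_delt: "x \<in> Ob B \<Longrightarrow>
      delt C (fob (carr P) x) \<cdot>\<^bsub>D\<^esub> gam P x
        = fun_ar C (gam P x) \<cdot>\<^bsub>D\<^esub> gam P (fun_ob S x) \<cdot>\<^bsub>D\<^esub> far (carr P) (delt S x)"
    and gam_eps: "x \<in> Ob B \<Longrightarrow>
      eps C (fob (carr P) x) \<cdot>\<^bsub>D\<^esub> gam P x = far (carr P) (eps S x)"
    and yang_baxter: "x \<in> Ob B \<Longrightarrow>
      gam P (fun_ob T x) \<cdot>\<^bsub>D\<^esub> far (carr P) (\<chi> x) \<cdot>\<^bsub>D\<^esub> sig P (fun_ob S x)
        = fun_ar C (sig P x) \<cdot>\<^bsub>D\<^esub> \<tau> (fob (carr P) x) \<cdot>\<^bsub>D\<^esub> fun_ar G (gam P x)"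

definition is_one_cell :: "('o, 'a) zero_cell \<Rightarrow> ('o, 'a) zero_cell \<Rightarrow> ('o, 'a) one_cell \<Rightarrow> bool"
where
  "is_one_cell X Y P \<longleftrightarrow>
    dist_one_cell (base X) (law X) (comT X) (comS X) (base Y) (law Y) (comT Y) (comS Y) P"

definition is_two_cell ::
  "('o, 'a) zero_cell \<Rightarrow> ('o, 'a) zero_cell \<Rightarrow> ('o, 'a) one_cell \<Rightarrow> ('o, 'a) one_cell
    \<Rightarrow> ('o \<Rightarrow> 'a) \<Rightarrow> bool"
where
  "is_two_cell X Y P Q \<alpha> \<longleftrightarrow>
    nat_trans (base X) (base Y) (carr P) (carr Q) \<alpha> \<and>
    (\<forall>x\<in>Ob (base X). \<alpha> (fun_ob (comT X) x) \<cdot>\<^bsub>base Y\<^esub> sig P x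
      = sig Q x \<cdot>\<^bsub>base Y\<^esub> fun_ar (comT Y) (\<alpha> x)) \<and>
    (\<forall>x\<in>Ob (base X). gam Q x \<cdot>\<^bsub>base Y\<^esub> \<alpha> (fun_ob (comS X) x)
      = fun_ar (comS Y) (\<alpha> x) \<cdot>\<^bsub>base Y\<^esub> gam P x)"

text \<open>
  The arrows of a category determine their domain and codomain, so a 2-cell, and below a
  morphism of coalgebras, is stored together with its source and target.
\<close>

record ('o, 'd) arrow =
  src :: "'o"
  tgt :: "'o"
  body :: "'d"

definition dist_hom ::
  "('o, 'a) zero_cell \<Rightarrow> ('o, 'a) zero_cell
    \<Rightarrow> (('o, 'a) one_cell, (('o, 'a) one_cell, 'o \<Rightarrow> 'a) arrow) cat"
where
  "dist_hom X Y =
    \<lparr>Ob = {P. is_one_cell X Y P},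
     Ar = {u. is_one_cell X Y (src u) \<and> is_one_cell X Y (tgt u)
            \<and> is_two_cell X Y (src u) (tgt u) (body u)},
     Dom = src,
     Cod = tgt,
     Idn = (\<lambda>P. \<lparr>src = P, tgt = P, body = idt (base X) (base Y) (carr P)\<rparr>),
     Cmp = (\<lambda>v u. \<lparr>src = src u, tgt = tgt v,
                    body = vcomp (base X) (base Y) (body v) (body u)\<rparr>)\<rparr>"

definition unit_cell :: "('o, 'a) zero_cell \<Rightarrow> ('o, 'a) one_cell" where
  "unit_cell X =
    \<lparr>carr = ftor_id (base X),
     sig = idt (base X) (base X) (Fun (comT X)),
     gam = idt (base X) (base X) (Fun (comS X))\<rparr>"

text \<open>
  The composite of \<open>P : X \<rightarrow> Y\<close> with \<open>Q : Y \<rightarrow> Z\<close> is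
  \<open>(\<Sigma>'\<Sigma>, \<Sigma>'\<sigma> \<circ> \<sigma>'\<Sigma>, \<gamma>'\<Sigma> \<circ> \<Sigma>'\<gamma>)\<close>, where \<open>P = (\<Sigma>, \<sigma>, \<gamma>)\<close> and
  \<open>Q = (\<Sigma>', \<sigma>', \<gamma>')\<close>.
\<close>

definition comp_cell ::
  "('o, 'a) zero_cell \<Rightarrow> ('o, 'a) zero_cell \<Rightarrow> ('o, 'a) one_cell \<Rightarrow> ('o, 'a) one_cell
    \<Rightarrow> ('o, 'a) one_cell"
where
  "comp_cell X Z Q P =
    \<lparr>carr = ftor_comp (base X) (carr Q) (carr P),
     sig = vcomp (base X) (base Z)
       (whisker_l (base X) (carr Q) (sig P)) (whisker_r (base X) (sig Q) (carr P)),
     gam = vcomp (base X) (base Z)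
       (whisker_r (base X) (gam Q) (carr P)) (whisker_l (base X) (carr Q) (gam P))\<rparr>"

definition dist_hcomp ::
  "('o, 'a) zero_cell \<Rightarrow> ('o, 'a) zero_cell \<Rightarrow> ('o, 'a) zero_cell
    \<Rightarrow> (('o, 'a) one_cell \<times> ('o, 'a) one_cell,
        (('o, 'a) one_cell, 'o \<Rightarrow> 'a) arrow \<times> (('o, 'a) one_cell, 'o \<Rightarrow> 'a) arrow,
        ('o, 'a) one_cell, (('o, 'a) one_cell, 'o \<Rightarrow> 'a) arrow) ftor"
where
  "dist_hcomp X Y Z =
    \<lparr>fob = (\<lambda>(Q, P)\<in>Ob (dist_hom Y Z) \<times> Ob (dist_hom X Y). comp_cell X Z Q P),
     far = (\<lambda>(v, u)\<in>Ar (dist_hom Y Z) \<times> Ar (dist_hom X Y).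
       \<lparr>src = comp_cell X Z (src v) (src u),
        tgt = comp_cell X Z (tgt v) (tgt u),
        body = hcomp (base X) (base Z) (body v) (carr (src v)) (body u) (carr (tgt u))\<rparr>)\<rparr>"

definition Dist ::
  "(('o, 'a) zero_cell, ('o, 'a) one_cell, (('o, 'a) one_cell, 'o \<Rightarrow> 'a) arrow) two_cat"
where
  "Dist = \<lparr>Ob2 = {X. is_zero_cell X}, Hom = dist_hom, Unit = unit_cell, HComp = dist_hcomp\<rparr>"

section \<open>Coalgebras over distributive laws\<close>

record ('x, 'y, 'o, 'a) coalg =
  cfun :: "('x, 'y, 'o, 'a) ftor"
  cdom :: "('x, 'y) cat"
  crho :: "'x \<Rightarrow> 'a"

locale chi_coalgebra =
  chi: distributive_law B \<chi> T S + M: cat_functor X B M +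
  rho: nat_trans X B "ftor_comp X (Fun T) M" "ftor_comp X (Fun S) M" \<rho>
  for B :: "('o, 'a) cat" and \<chi> T S and M :: "('x, 'y, 'o, 'a) ftor" and X \<rho> +
  assumes delt_rho: "x \<in> Ob X \<Longrightarrow>
      delt S (fob M x) \<cdot>\<^bsub>B\<^esub> \<rho> x
        = fun_ar S (\<rho> x) \<cdot>\<^bsub>B\<^esub> \<chi> (fob M x) \<cdot>\<^bsub>B\<^esub> fun_ar T (\<rho> x) \<cdot>\<^bsub>B\<^esub> delt T (fob M x)"
    and eps_rho: "x \<in> Ob X \<Longrightarrow> eps S (fob M x) \<cdot>\<^bsub>B\<^esub> \<rho> x = eps T (fob M x)"

definition is_coalg :: "('o, 'a) zero_cell \<Rightarrow> ('x, 'y, 'o, 'a) coalg \<Rightarrow> bool" where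
  "is_coalg Z m \<longleftrightarrow>
    chi_coalgebra (base Z) (law Z) (comT Z) (comS Z) (cfun m) (cdom m) (crho m)"

definition is_coalg_mor ::
  "('o, 'a) zero_cell \<Rightarrow> ('x, 'y, 'o, 'a) coalg \<Rightarrow> ('x, 'y, 'o, 'a) coalg
    \<Rightarrow> ('x, 'y, 'x, 'y) ftor \<times> ('x \<Rightarrow> 'a) \<Rightarrow> bool"
where
  "is_coalg_mor Z m n = (\<lambda>(F, \<phi>).
    cat_functor (cdom m) (cdom n) F \<and>
    nat_trans (cdom m) (base Z) (cfun m) (ftor_comp (cdom m) (cfun n) F) \<phi> \<and>
    (\<forall>x\<in>Ob (cdom m). fun_ar (comS Z) (\<phi> x) \<cdot>\<^bsub>base Z\<^esub> crho m x
      = crho n (fob F x) \<cdot>\<^bsub>base Z\<^esub> fun_ar (comT Z) (\<phi> x)))"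

type_synonym ('x, 'y, 'o, 'a) coalg_mor =
  "(('x, 'y, 'o, 'a) coalg, ('x, 'y, 'x, 'y) ftor \<times> ('x \<Rightarrow> 'a)) arrow"

text \<open>The composite of \<open>(F, \<phi>)\<close> with \<open>(F', \<phi>')\<close> is \<open>(F'F, \<phi>'F \<circ> \<phi>)\<close>.\<close>

definition coalg_cat ::
  "('o, 'a) zero_cell \<Rightarrow> (('x, 'y, 'o, 'a) coalg, ('x, 'y, 'o, 'a) coalg_mor) cat"
where
  "coalg_cat Z =
    \<lparr>Ob = {m. is_coalg Z m},
     Ar = {u. is_coalg Z (src u) \<and> is_coalg Z (tgt u) \<and> is_coalg_mor Z (src u) (tgt u) (body u)},
     Dom = src,
     Cod = tgt,
     Idn = (\<lambda>m. \<lparr>src = m, tgt = m,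
       body = (ftor_id (cdom m), idt (cdom m) (base Z) (cfun m))\<rparr>),
     Cmp = (\<lambda>v u. \<lparr>src = src u, tgt = tgt v,
       body = (let X = cdom (src u); (F, \<phi>) = body u; (F', \<phi>') = body v
               in (ftor_comp X F' F, vcomp X (base Z) (whisker_r X \<phi>' F) \<phi>))\<rparr>)\<rparr>"

text \<open>\<open>(\<Sigma>, \<sigma>, \<gamma>) \<rhd> (M, X, \<rho>) = (\<Sigma>M, X, \<gamma>M \<circ> \<Sigma>\<rho> \<circ> \<sigma>M)\<close>\<close>

definition act_ob ::
  "('o, 'a) zero_cell \<Rightarrow> ('o, 'a) one_cell \<Rightarrow> ('x, 'y, 'o, 'a) coalg \<Rightarrow> ('x, 'y, 'o, 'a) coalg"
where
  "act_ob Y P m = (let X = cdom m; M = cfun m in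
    \<lparr>cfun = ftor_comp X (carr P) M,
     cdom = X,
     crho = vcomp X (base Y) (whisker_r X (gam P) M)
       (vcomp X (base Y) (whisker_l X (carr P) (crho m)) (whisker_r X (sig P) M))\<rparr>)"

text \<open>\<open>\<alpha> \<rhd> (F, \<phi>) = (F, \<alpha>\<phi>)\<close>, with \<open>\<alpha> : \<Sigma> \<Rightarrow> \<Sigma>'\<close> and \<open>\<phi> : M \<Rightarrow> M'F\<close>\<close>

definition act_ar ::
  "('o, 'a) zero_cell \<Rightarrow> (('o, 'a) one_cell, 'o \<Rightarrow> 'a) arrow
    \<Rightarrow> ('x, 'y, 'o, 'a) coalg_mor \<Rightarrow> ('x, 'y, 'o, 'a) coalg_mor"
where
  "act_ar Y v u = (let X = cdom (src u); (F, \<phi>) = body u in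
    \<lparr>src = act_ob Y (src v) (src u),
     tgt = act_ob Y (tgt v) (tgt u),
     body = (F, hcomp X (base Y) (body v) (carr (src v)) \<phi> (ftor_comp X (cfun (tgt u)) F))\<rparr>)"

definition coalg_act ::
  "('o, 'a) zero_cell \<Rightarrow> ('o, 'a) zero_cell
    \<Rightarrow> (('o, 'a) one_cell \<times> ('x, 'y, 'o, 'a) coalg,
        (('o, 'a) one_cell, 'o \<Rightarrow> 'a) arrow \<times> ('x, 'y, 'o, 'a) coalg_mor,
        ('x, 'y, 'o, 'a) coalg, ('x, 'y, 'o, 'a) coalg_mor) ftor"
where
  "coalg_act Z Y =
    \<lparr>fob = (\<lambda>(P, m)\<in>Ob (dist_hom Z Y) \<times> Ob (coalg_cat Z). act_ob Y P m),
     far = (\<lambda>(v, u)\<in>Ar (dist_hom Z Y) \<times> Ar (coalg_cat Z). act_ar Y v u)\<rparr>"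

end

theory Submission
  imports Defs
begin

text \<open>
  Both \<^term>\<open>Dist\<close> and its action on coalgebras consist of pasting diagrams of functors and
  natural transformations, and every claim is an equation between such pastings. Three kinds of
  argument occur.

  \<^item> The structure maps of a composite 1-cell \<open>(\<Sigma>'\<Sigma>, \<Sigma>'\<sigma> \<circ> \<sigma>'\<Sigma>, \<gamma>'\<Sigma> \<circ> \<Sigma>'\<gamma>)\<close>, and the structure map
    \<open>\<gamma>M \<circ> \<Sigma>\<rho> \<circ> \<sigma>M\<close> of \<open>(\<Sigma>, \<sigma>, \<gamma>) \<rhd> (M, X, \<rho>)\<close>, satisfy their axioms. In the axiom for the
    coalgebra, \<open>\<delta>\<Sigma> \<circ> \<gamma>\<close> and \<open>\<delta> \<circ> \<rho>\<close> are expanded first, so that the \<open>\<rho>\<close> there gives way to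
    \<open>S\<rho> \<circ> \<chi>M \<circ> T\<rho> \<circ> \<delta>M\<close>; naturality of \<open>\<sigma>\<close> and \<open>\<gamma>\<close> at \<open>\<rho>\<close> moves the two copies of \<open>\<rho>\<close> outwards and
    leaves \<open>\<gamma>T \<circ> \<Sigma>\<chi> \<circ> \<sigma>S\<close> in the middle, which the Yang-Baxter equation turns into
    \<open>C\<sigma> \<circ> \<tau>\<Sigma> \<circ> G\<gamma>\<close>. What results are two copies of \<open>\<gamma> \<circ> \<Sigma>\<rho> \<circ> \<sigma>\<close> around \<open>\<tau>\<close>
    (\<open>act_ob_coalg\<close>). The Yang-Baxter equation of a composite 1-cell is obtained in the same way from
    those of its factors (\<open>comp_one_cell\<close>).
  \<^item> Horizontal composites of 2-cells, with each other and with morphisms of coalgebras, are again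
    compatible with the structure maps: the second factor passes them by its own compatibility and
    naturality of the structure maps, the first by its compatibility and its own naturality
    (\<open>two_cell_hcomp\<close>, \<open>act_mor\<close>). Since the action on
    morphisms is horizontal composition, its functoriality is the interchange law.
  \<^item> The strict associativity and unit laws hold because composition of functors, whiskering and
    horizontal composition are strictly associative and unital. Functors and natural transformations
    are extensional, so it is enough to compare values on objects and arrows.

  All equations are checked on components, in a category whose arrows form a set, so each composition
  carries side conditions. The rules on domains and codomains are therefore given to the simplifier,
  which then works with composites bracketed to the right.
\<close>

section \<open>Calculating in a category\<close>

lemmas (in category) [simp] =
  Dom_Ob Cod_Ob Idn_Ar Dom_Idn Cod_Idn Cmp_Ar Dom_Cmp Cod_Cmp Cmp_assoc

text \<open>
  In the identity laws the object is only required to equal the domain or codomain, since that of a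
  component of a transformation between composite functors has to be computed first.
\<close>

lemma (in category) Cmp_Idn_eq [simp]: "f \<in> Ar C \<Longrightarrow> x = Dom C f \<Longrightarrow> f \<cdot> Idn C x = f"
  by (simp add: Cmp_Idn)

lemma (in category) Idn_Cmp_eq [simp]: "f \<in> Ar C \<Longrightarrow> x = Cod C f \<Longrightarrow> Idn C x \<cdot> f = f"
  by (simp add: Idn_Cmp)

text \<open>
  An equation \<open>g \<cdot> f = k\<close> does not rewrite the right-bracketed composite \<open>g \<cdot> (f \<cdot> z)\<close>; the next two
  lemmas extend an equation whose left side has two or three factors to a longer path.
\<close>

lemma (in category) Cmp_pasted:
  assumes "g \<cdot> f = k" "g \<in> Ar C" "f \<in> Ar C" "z \<in> Ar C" "Dom C g = Cod C f" "Dom C f = Cod C z"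
  shows "g \<cdot> (f \<cdot> z) = k \<cdot> z"
  using assms Cmp_assoc by metis

lemma (in category) Cmp_pasted3:
  assumes "h \<cdot> (g \<cdot> f) = k" "h \<in> Ar C" "g \<in> Ar C" "f \<in> Ar C" "z \<in> Ar C"
    and "Dom C h = Cod C g" "Dom C g = Cod C f" "Dom C f = Cod C z"
  shows "h \<cdot> (g \<cdot> (f \<cdot> z)) = k \<cdot> z"
  using assms Cmp_pasted[of h "g \<cdot> f" k z] by simp

lemma (in cat_functor) fob_Ob [simp]: "x \<in> Ob C \<Longrightarrow> fob F x \<in> Ob D"
  using fob by auto

lemma (in cat_functor) far_Ar [simp]: "f \<in> Ar C \<Longrightarrow> far F f \<in> Ar D"
  using far by auto

lemmas (in cat_functor) [simp] = Dom_far Cod_far far_Idn far_Cmp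

lemma (in nat_trans) component_Ar [simp]: "x \<in> Ob C \<Longrightarrow> \<alpha> x \<in> Ar D"
  using component by auto

lemmas (in nat_trans) [simp] = Dom_component Cod_component

lemma ftor_simps [simp]:
  "x \<in> Ob C \<Longrightarrow> fob (ftor_comp C G F) x = fob G (fob F x)"
  "f \<in> Ar C \<Longrightarrow> far (ftor_comp C G F) f = far G (far F f)"
  "x \<in> Ob C \<Longrightarrow> fob (ftor_id C) x = x"
  "f \<in> Ar C \<Longrightarrow> far (ftor_id C) f = f"
  by (simp_all add: ftor_comp_def ftor_id_def)

lemma component_simps [simp]:
  "x \<in> Ob C \<Longrightarrow> idt C D F x = Idn D (fob F x)"
  "x \<in> Ob C \<Longrightarrow> vcomp C D \<beta> \<alpha> x = \<beta> x \<cdot>\<^bsub>D\<^esub> \<alpha> x"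
  "x \<in> Ob C \<Longrightarrow> whisker_l C H \<alpha> x = far H (\<alpha> x)"
  "x \<in> Ob C \<Longrightarrow> whisker_r C \<theta> F x = \<theta> (fob F x)"
  "x \<in> Ob C \<Longrightarrow> hcomp C E \<theta> H \<alpha> F x = \<theta> (fob F x) \<cdot>\<^bsub>E\<^esub> far H (\<alpha> x)"
  by (simp_all add: idt_def vcomp_def whisker_l_def whisker_r_def hcomp_def)

lemma component_extensional [simp]:
  "idt C D F \<in> extensional (Ob C)" "vcomp C D \<beta> \<alpha> \<in> extensional (Ob C)"
  "whisker_l C H \<alpha> \<in> extensional (Ob C)" "whisker_r C \<theta> F \<in> extensional (Ob C)"
  "hcomp C E \<theta> H \<alpha> F \<in> extensional (Ob C)"
  by (simp_all add: idt_def vcomp_def whisker_l_def whisker_r_def hcomp_def)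

section \<open>Functors and natural transformations\<close>

lemma ftor_eqI:
  assumes "fob F \<in> extensional (Ob C)" "fob G \<in> extensional (Ob C)"
    and "far F \<in> extensional (Ar C)" "far G \<in> extensional (Ar C)"
    and "\<And>x. x \<in> Ob C \<Longrightarrow> fob F x = fob G x" "\<And>f. f \<in> Ar C \<Longrightarrow> far F f = far G f"
  shows "F = (G :: ('o, 'a, 'p, 'b) ftor)"
  using assms by (intro ftor.equality) (auto intro: extensionalityI)

lemma (in cat_functor) fob_extensional [simp]: "fob F \<in> extensional (Ob C)"
  using fob by (simp add: PiE_def)

lemma (in cat_functor) far_extensional [simp]: "far F \<in> extensional (Ar C)"
  using far by (simp add: PiE_def)

lemma (in nat_trans) component_ext [simp]: "\<alpha> \<in> extensional (Ob C)"
  using component by (simp add: PiE_def)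

lemma ftor_comp_extensional [simp]:
  "fob (ftor_comp C G F) \<in> extensional (Ob C)" "far (ftor_comp C G F) \<in> extensional (Ar C)"
  by (simp_all add: ftor_comp_def)

lemma (in category) ftor_id_functor: "cat_functor C C (ftor_id C)"
  by unfold_locales (auto simp: ftor_id_def)

lemma ftor_comp_functor:
  assumes "cat_functor C D F" "cat_functor D E G"
  shows "cat_functor C E (ftor_comp C G F)"
proof -
  interpret F: cat_functor C D F by fact
  interpret G: cat_functor D E G by fact
  show ?thesis by unfold_locales (auto simp: ftor_comp_def)
qed

lemma (in cat_functor) ftor_comp_id_right: "ftor_comp C F (ftor_id C) = F"
  by (rule ftor_eqI[of _ C]) auto

lemma (in cat_functor) ftor_comp_id_left: "ftor_comp C (ftor_id D) F = F"
  by (rule ftor_eqI[of _ C]) auto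

lemma (in cat_functor) ftor_comp_assoc:
  "ftor_comp C (ftor_comp D H G) F = ftor_comp C H (ftor_comp C G F)"
  by (rule ftor_eqI[of _ C]) auto

lemma nat_transI:
  assumes "cat_functor C D F" "cat_functor C D G" "\<alpha> \<in> extensional (Ob C)"
    and "\<And>x. x \<in> Ob C \<Longrightarrow> \<alpha> x \<in> Ar D \<and> Dom D (\<alpha> x) = fob F x \<and> Cod D (\<alpha> x) = fob G x"
    and "\<And>f. f \<in> Ar C \<Longrightarrow> \<alpha> (Cod C f) \<cdot>\<^bsub>D\<^esub> far F f = far G f \<cdot>\<^bsub>D\<^esub> \<alpha> (Dom C f)"
  shows "nat_trans C D F G \<alpha>"
  using assms by (simp add: nat_trans_def nat_trans_axioms_def PiE_iff)

lemma (in cat_functor) idt_nat_trans: "nat_trans C D F F (idt C D F)"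
  by (rule nat_transI) (auto intro: cat_functor_axioms)

lemma vcomp_nat_trans:
  assumes "nat_trans C D F G \<alpha>" "nat_trans C D G H \<beta>"
  shows "nat_trans C D F H (vcomp C D \<beta> \<alpha>)"
proof -
  interpret a: nat_trans C D F G \<alpha> by fact
  interpret b: nat_trans C D G H \<beta> by fact
  show ?thesis
  proof (rule nat_transI)
    fix f assume f: "f \<in> Ar C"
    have "vcomp C D \<beta> \<alpha> (Cod C f) \<cdot>\<^bsub>D\<^esub> far F f = \<beta> (Cod C f) \<cdot>\<^bsub>D\<^esub> (far G f \<cdot>\<^bsub>D\<^esub> \<alpha> (Dom C f))"
      using f by (simp add: a.naturality)
    also have "\<dots> = far H f \<cdot>\<^bsub>D\<^esub> vcomp C D \<beta> \<alpha> (Dom C f)"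
      using f by (simp add: a.F.D.Cmp_pasted[OF b.naturality])
    finally show "vcomp C D \<beta> \<alpha> (Cod C f) \<cdot>\<^bsub>D\<^esub> far F f = far H f \<cdot>\<^bsub>D\<^esub> vcomp C D \<beta> \<alpha> (Dom C f)" .
  qed (auto intro: a.F.cat_functor_axioms b.G.cat_functor_axioms)
qed

lemma whisker_l_nat_trans:
  assumes "nat_trans C D F G \<alpha>" "cat_functor D E H"
  shows "nat_trans C E (ftor_comp C H F) (ftor_comp C H G) (whisker_l C H \<alpha>)"
proof -
  interpret a: nat_trans C D F G \<alpha> by fact
  interpret H: cat_functor D E H by fact
  show ?thesis
    by (rule nat_transI)
      (auto intro!: ftor_comp_functor a.F.cat_functor_axioms a.G.cat_functor_axioms
        H.cat_functor_axioms simp: a.naturality simp flip: H.far_Cmp)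
qed

lemma whisker_r_nat_trans:
  assumes "cat_functor C D F" "nat_trans D E H K \<theta>"
  shows "nat_trans C E (ftor_comp C H F) (ftor_comp C K F) (whisker_r C \<theta> F)"
proof -
  interpret F: cat_functor C D F by fact
  interpret t: nat_trans D E H K \<theta> by fact
  show ?thesis
    by (rule nat_transI)
      (auto intro!: ftor_comp_functor F.cat_functor_axioms t.F.cat_functor_axioms
        t.G.cat_functor_axioms simp: t.naturality simp flip: F.Cod_far F.Dom_far)
qed

lemma hcomp_nat_trans:
  assumes "nat_trans C D F G \<alpha>" "nat_trans D E H K \<theta>"
  shows "nat_trans C E (ftor_comp C H F) (ftor_comp C K G) (hcomp C E \<theta> H \<alpha> G)"
  unfolding hcomp_def
  by (rule vcomp_nat_trans[OF whisker_l_nat_trans whisker_r_nat_trans])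
    (use assms in \<open>auto simp: nat_trans_def\<close>)

text \<open>
  The four factors are the same on both sides; the middle two are exchanged by naturality of \<open>\<theta>\<close> at
  the components of \<open>\<alpha>'\<close>.
\<close>

lemma interchange:
  assumes "nat_trans C D F G \<alpha>" "nat_trans C D G G' \<alpha>'"
    and "nat_trans D E H K \<theta>" "nat_trans D E K K' \<theta>'"
  shows "hcomp C E (vcomp D E \<theta>' \<theta>) H (vcomp C D \<alpha>' \<alpha>) G'
    = vcomp C E (hcomp C E \<theta>' K \<alpha>' G') (hcomp C E \<theta> H \<alpha> G)"
proof -
  interpret a: nat_trans C D F G \<alpha> by fact
  interpret a': nat_trans C D G G' \<alpha>' by fact
  interpret t: nat_trans D E H K \<theta> by fact
  interpret t': nat_trans D E K K' \<theta>' by fact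
  show ?thesis
  proof (rule extensionalityI[of _ "Ob C"])
    fix x assume x: "x \<in> Ob C"
    have square: "\<theta> (fob G' x) \<cdot>\<^bsub>E\<^esub> far H (\<alpha>' x) = far K (\<alpha>' x) \<cdot>\<^bsub>E\<^esub> \<theta> (fob G x)"
      using t.naturality[of "\<alpha>' x"] x by simp
    with x show "hcomp C E (vcomp D E \<theta>' \<theta>) H (vcomp C D \<alpha>' \<alpha>) G' x
        = vcomp C E (hcomp C E \<theta>' K \<alpha>' G') (hcomp C E \<theta> H \<alpha> G) x"
      by (simp add: t.F.D.Cmp_pasted[OF square])
  qed auto
qed

lemma (in nat_trans) vcomp_idt_right: "vcomp C D \<alpha> (idt C D F) = \<alpha>"
  by (rule extensionalityI[of _ "Ob C"]) auto

lemma (in nat_trans) vcomp_idt_left: "vcomp C D (idt C D G) \<alpha> = \<alpha>"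
  by (rule extensionalityI[of _ "Ob C"]) auto

lemma vcomp_assoc:
  assumes "nat_trans C D F G \<alpha>" "nat_trans C D G H \<beta>" "nat_trans C D H K \<gamma>"
  shows "vcomp C D (vcomp C D \<gamma> \<beta>) \<alpha> = vcomp C D \<gamma> (vcomp C D \<beta> \<alpha>)"
proof -
  interpret a: nat_trans C D F G \<alpha> by fact
  interpret b: nat_trans C D G H \<beta> by fact
  interpret c: nat_trans C D H K \<gamma> by fact
  show ?thesis by (rule extensionalityI[of _ "Ob C"]) auto
qed

lemma hcomp_idt:
  assumes "cat_functor C D F" "cat_functor D E H"
  shows "hcomp C E (idt D E H) H (idt C D F) F = idt C E (ftor_comp C H F)"
proof -
  interpret F: cat_functor C D F by fact
  interpret H: cat_functor D E H by fact
  show ?thesis by (rule extensionalityI[of _ "Ob C"]) auto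
qed

lemma hcomp_assoc:
  assumes "nat_trans A C F G \<alpha>" "nat_trans C D H K \<beta>" "nat_trans D E L N \<gamma>"
  shows "hcomp A E (hcomp C E \<gamma> L \<beta> K) (ftor_comp C L H) \<alpha> G
    = hcomp A E \<gamma> L (hcomp A D \<beta> H \<alpha> G) (ftor_comp A K G)"
proof -
  interpret a: nat_trans A C F G \<alpha> by fact
  interpret b: nat_trans C D H K \<beta> by fact
  interpret c: nat_trans D E L N \<gamma> by fact
  show ?thesis by (rule extensionalityI[of _ "Ob A"]) auto
qed

lemma (in nat_trans) hcomp_unit_left:
  "hcomp C D (idt D D (ftor_id D)) (ftor_id D) \<alpha> G = \<alpha>"
  by (rule extensionalityI[of _ "Ob C"]) auto

lemma (in nat_trans) hcomp_unit_right:
  "hcomp C D \<alpha> F (idt C C (ftor_id C)) (ftor_id C) = \<alpha>"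
  by (rule extensionalityI[of _ "Ob C"]) auto

lemma prod_cat_category:
  assumes "category C" "category D"
  shows "category (prod_cat C D)"
proof -
  interpret C: category C by fact
  interpret D: category D by fact
  show ?thesis by unfold_locales (auto simp: prod_cat_def)
qed

section \<open>The 2-category of distributive laws\<close>

text \<open>
  A 2-cell bundled with its source and target 1-cells, so that one interpretation provides the axioms
  of all of them.
\<close>

locale dist_two_cell =
  P: dist_one_cell B \<chi> T S D \<tau> G C P + Q: dist_one_cell B \<chi> T S D \<tau> G C Q +
  nat_trans B D "carr P" "carr Q" \<alpha>
  for B :: "('o, 'a) cat" and \<chi> T S and D :: "('o, 'a) cat" and \<tau> G C
    and P Q :: "('o, 'a) one_cell" and \<alpha> +
  assumes sig_component: "x \<in> Ob B \<Longrightarrow>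
      \<alpha> (fun_ob T x) \<cdot>\<^bsub>D\<^esub> sig P x = sig Q x \<cdot>\<^bsub>D\<^esub> fun_ar G (\<alpha> x)"
    and gam_component: "x \<in> Ob B \<Longrightarrow>
      gam Q x \<cdot>\<^bsub>D\<^esub> \<alpha> (fun_ob S x) = fun_ar C (\<alpha> x) \<cdot>\<^bsub>D\<^esub> gam P x"

abbreviation two_cell ::
  "('o, 'a) zero_cell \<Rightarrow> ('o, 'a) zero_cell \<Rightarrow> ('o, 'a) one_cell \<Rightarrow> ('o, 'a) one_cell
    \<Rightarrow> ('o \<Rightarrow> 'a) \<Rightarrow> bool"
where
  "two_cell X Y \<equiv>
    dist_two_cell (base X) (law X) (comT X) (comS X) (base Y) (law Y) (comT Y) (comS Y)"

lemma two_cell_iff: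
  "two_cell X Y P Q \<alpha> \<longleftrightarrow> is_one_cell X Y P \<and> is_one_cell X Y Q \<and> is_two_cell X Y P Q \<alpha>"
  by (auto simp: dist_two_cell_def dist_two_cell_axioms_def is_one_cell_def is_two_cell_def)

lemma dist_hom_simps [simp]:
  "P \<in> Ob (dist_hom X Y) \<longleftrightarrow> is_one_cell X Y P"
  "u \<in> Ar (dist_hom X Y) \<longleftrightarrow> two_cell X Y (src u) (tgt u) (body u)"
  "Dom (dist_hom X Y) = src" "Cod (dist_hom X Y) = tgt"
  "Idn (dist_hom X Y) P = \<lparr>src = P, tgt = P, body = idt (base X) (base Y) (carr P)\<rparr>"
  "Cmp (dist_hom X Y) v u
    = \<lparr>src = src u, tgt = tgt v, body = vcomp (base X) (base Y) (body v) (body u)\<rparr>"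
  unfolding two_cell_iff by (simp_all add: dist_hom_def)

lemma two_cell_idt:
  assumes "is_one_cell X Y P"
  shows "two_cell X Y P P (idt (base X) (base Y) (carr P))"
proof -
  interpret P: dist_one_cell "base X" "law X" "comT X" "comS X"
      "base Y" "law Y" "comT Y" "comS Y" P
    using assms by (simp add: is_one_cell_def)
  show ?thesis
    by (intro dist_two_cell.intro dist_two_cell_axioms.intro P.P.idt_nat_trans
        P.dist_one_cell_axioms) simp_all
qed

lemma two_cell_vcomp:
  assumes "two_cell X Y P Q \<alpha>" "two_cell X Y Q R \<beta>"
  shows "two_cell X Y P R (vcomp (base X) (base Y) \<beta> \<alpha>)"
proof -
  interpret a: dist_two_cell "base X" "law X" "comT X" "comS X"
      "base Y" "law Y" "comT Y" "comS Y" P Q \<alpha> by fact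
  interpret b: dist_two_cell "base X" "law X" "comT X" "comS X"
      "base Y" "law Y" "comT Y" "comS Y" Q R \<beta> by fact
  note pasted = a.P.tau.T.T.C.Cmp_pasted
  show ?thesis
  proof (intro dist_two_cell.intro dist_two_cell_axioms.intro
      vcomp_nat_trans[OF a.nat_trans_axioms b.nat_trans_axioms])
    fix x assume x [simp]: "x \<in> Ob (base X)"
    show "vcomp (base X) (base Y) \<beta> \<alpha> (fun_ob (comT X) x) \<cdot>\<^bsub>base Y\<^esub> sig P x
        = sig R x \<cdot>\<^bsub>base Y\<^esub> fun_ar (comT Y) (vcomp (base X) (base Y) \<beta> \<alpha> x)"
      by (simp add: a.sig_component pasted[OF b.sig_component])
    show "gam R x \<cdot>\<^bsub>base Y\<^esub> vcomp (base X) (base Y) \<beta> \<alpha> (fun_ob (comS X) x)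
        = fun_ar (comS Y) (vcomp (base X) (base Y) \<beta> \<alpha> x) \<cdot>\<^bsub>base Y\<^esub> gam P x"
      by (simp add: a.gam_component pasted[OF b.gam_component])
  qed (rule a.P.dist_one_cell_axioms b.Q.dist_one_cell_axioms)+
qed

lemma two_cell_nat_trans:
  "two_cell X Y P Q \<alpha> \<Longrightarrow> nat_trans (base X) (base Y) (carr P) (carr Q) \<alpha>"
  by (simp add: dist_two_cell_def)

lemma two_cell_ends:
  "two_cell X Y P Q \<alpha> \<Longrightarrow> is_one_cell X Y P" "two_cell X Y P Q \<alpha> \<Longrightarrow> is_one_cell X Y Q"
  by (simp_all add: two_cell_iff)

lemma one_cell_functor: "is_one_cell X Y P \<Longrightarrow> cat_functor (base X) (base Y) (carr P)"
  by (simp add: is_one_cell_def dist_one_cell_def)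

lemma dist_hom_category: "category (dist_hom X Y)"
proof
  fix w v u
  assume "w \<in> Ar (dist_hom X Y)" "v \<in> Ar (dist_hom X Y)" "u \<in> Ar (dist_hom X Y)"
    "Dom (dist_hom X Y) w = Cod (dist_hom X Y) v" "Dom (dist_hom X Y) v = Cod (dist_hom X Y) u"
  then show "Cmp (dist_hom X Y) (Cmp (dist_hom X Y) w v) u
      = Cmp (dist_hom X Y) w (Cmp (dist_hom X Y) v u)"
    using vcomp_assoc[of "base X" "base Y" "carr (src u)" "carr (tgt u)" "body u"
        "carr (tgt v)" "body v" "carr (tgt w)" "body w"]
    by (simp add: two_cell_nat_trans)
qed (auto intro: two_cell_ends two_cell_idt two_cell_vcomp
    simp: nat_trans.vcomp_idt_left[OF two_cell_nat_trans]
      nat_trans.vcomp_idt_right[OF two_cell_nat_trans])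

lemma unit_one_cell:
  assumes "is_zero_cell X"
  shows "is_one_cell X X (unit_cell X)"
proof -
  interpret X: distributive_law "base X" "law X" "comT X" "comS X"
    using assms by (simp add: is_zero_cell_def)
  show ?thesis
    unfolding is_one_cell_def
    by (rule dist_one_cell.intro, (rule X.distributive_law_axioms)+)
      (auto simp: unit_cell_def dist_one_cell_axioms_def X.delt_T
          X.T.T.ftor_comp_id_left X.T.T.ftor_comp_id_right
          X.S.T.ftor_comp_id_left X.S.T.ftor_comp_id_right
        intro: X.T.T.idt_nat_trans X.S.T.idt_nat_trans X.T.T.C.ftor_id_functor)
qed

text \<open>
  Each axiom of the composite is the image under \<open>Q\<close> of the axiom of \<open>P\<close>, pasted with the axiom of \<open>Q\<close>
  at \<open>P\<close>. Where both occur, naturality of the structure maps of \<open>Q\<close> brings the factors into place.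
\<close>

lemma comp_one_cell:
  assumes "is_one_cell X Y P" "is_one_cell Y Z Q"
  shows "is_one_cell X Z (comp_cell X Z Q P)"
proof -
  interpret P: dist_one_cell "base X" "law X" "comT X" "comS X"
      "base Y" "law Y" "comT Y" "comS Y" P
    using assms by (simp add: is_one_cell_def)
  interpret Q: dist_one_cell "base Y" "law Y" "comT Y" "comS Y"
      "base Z" "law Z" "comT Z" "comS Z" Q
    using assms by (simp add: is_one_cell_def)
  note pasted = Q.tau.T.T.C.Cmp_pasted and pasted3 = Q.tau.T.T.C.Cmp_pasted3
  let ?R = "comp_cell X Z Q P"
  have carr: "carr ?R = ftor_comp (base X) (carr Q) (carr P)"
    by (simp add: comp_cell_def)
  have sig: "sig ?R x = far (carr Q) (sig P x) \<cdot>\<^bsub>base Z\<^esub> sig Q (fob (carr P) x)"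
    and gam: "gam ?R x = gam Q (fob (carr P) x) \<cdot>\<^bsub>base Z\<^esub> far (carr Q) (gam P x)"
    if "x \<in> Ob (base X)" for x
    using that by (simp_all add: comp_cell_def)
  have sig_nat: "nat_trans (base X) (base Z) (ftor_comp (base X) (Fun (comT Z)) (carr ?R))
      (ftor_comp (base X) (carr ?R) (Fun (comT X))) (sig ?R)"
    using vcomp_nat_trans[OF
        whisker_r_nat_trans[OF P.P.cat_functor_axioms Q.sig.nat_trans_axioms,
          unfolded P.P.ftor_comp_assoc]
        whisker_l_nat_trans[OF P.sig.nat_trans_axioms Q.P.cat_functor_axioms]]
    by (simp add: comp_cell_def P.chi.T.T.ftor_comp_assoc)
  have gam_nat: "nat_trans (base X) (base Z) (ftor_comp (base X) (carr ?R) (Fun (comS X)))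
      (ftor_comp (base X) (Fun (comS Z)) (carr ?R)) (gam ?R)"
    using vcomp_nat_trans[OF
        whisker_l_nat_trans[OF P.gam.nat_trans_axioms Q.P.cat_functor_axioms]
        whisker_r_nat_trans[OF P.P.cat_functor_axioms Q.gam.nat_trans_axioms,
          unfolded P.P.ftor_comp_assoc]]
    by (simp add: comp_cell_def P.chi.S.T.ftor_comp_assoc)
  show ?thesis
    unfolding is_one_cell_def
  proof (intro dist_one_cell.intro dist_one_cell_axioms.intro sig_nat gam_nat)
    show "cat_functor (base X) (base Z) (carr ?R)"
      unfolding carr by (rule ftor_comp_functor P.P.cat_functor_axioms Q.P.cat_functor_axioms)+
  next
    fix x assume x [simp]: "x \<in> Ob (base X)"
    let ?P = "fob (carr P)" and ?Q = "far (carr Q)"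
    have sig_sig: "?Q (fun_ar (comT Y) (sig P x)) \<cdot>\<^bsub>base Z\<^esub> sig Q (fun_ob (comT Y) (?P x))
        = sig Q (?P (fun_ob (comT X) x)) \<cdot>\<^bsub>base Z\<^esub> fun_ar (comT Z) (?Q (sig P x))"
      using Q.sig.naturality[of "sig P x"] by simp
    have sig_gam: "?Q (fun_ar (comT Y) (gam P x)) \<cdot>\<^bsub>base Z\<^esub> sig Q (?P (fun_ob (comS X) x))
        = sig Q (fun_ob (comS Y) (?P x)) \<cdot>\<^bsub>base Z\<^esub> fun_ar (comT Z) (?Q (gam P x))"
      using Q.sig.naturality[of "gam P x"] by simp
    have gam_sig: "gam Q (?P (fun_ob (comT X) x)) \<cdot>\<^bsub>base Z\<^esub> ?Q (fun_ar (comS Y) (sig P x))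
        = fun_ar (comS Z) (?Q (sig P x)) \<cdot>\<^bsub>base Z\<^esub> gam Q (fun_ob (comT Y) (?P x))"
      using Q.gam.naturality[of "sig P x"] by simp
    have gam_gam: "gam Q (fun_ob (comS Y) (?P x)) \<cdot>\<^bsub>base Z\<^esub> ?Q (fun_ar (comS Y) (gam P x))
        = fun_ar (comS Z) (?Q (gam P x)) \<cdot>\<^bsub>base Z\<^esub> gam Q (?P (fun_ob (comS X) x))"
      using Q.gam.naturality[of "gam P x"] by simp
    have Q_sig_delt: "?Q (far (carr P) (delt (comT X) x)) \<cdot>\<^bsub>base Z\<^esub> ?Q (sig P x)
        = ?Q (sig P (fun_ob (comT X) x)) \<cdot>\<^bsub>base Z\<^esub> ?Q (fun_ar (comT Y) (sig P x))
          \<cdot>\<^bsub>base Z\<^esub> ?Q (delt (comT Y) (?P x))"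
      using arg_cong[OF P.sig_delt[OF x], of ?Q] by simp
    have Q_sig_eps: "?Q (far (carr P) (eps (comT X) x)) \<cdot>\<^bsub>base Z\<^esub> ?Q (sig P x)
        = ?Q (eps (comT Y) (?P x))"
      using arg_cong[OF P.sig_eps[OF x], of ?Q] by simp
    have Q_gam_delt: "?Q (delt (comS Y) (?P x)) \<cdot>\<^bsub>base Z\<^esub> ?Q (gam P x)
        = ?Q (fun_ar (comS Y) (gam P x)) \<cdot>\<^bsub>base Z\<^esub> ?Q (gam P (fun_ob (comS X) x))
          \<cdot>\<^bsub>base Z\<^esub> ?Q (far (carr P) (delt (comS X) x))"
      using arg_cong[OF P.gam_delt[OF x], of ?Q] by simp
    have Q_gam_eps: "?Q (eps (comS Y) (?P x)) \<cdot>\<^bsub>base Z\<^esub> ?Q (gam P x)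
        = ?Q (far (carr P) (eps (comS X) x))"
      using arg_cong[OF P.gam_eps[OF x], of ?Q] by simp
    have Q_yang_baxter: "?Q (gam P (fun_ob (comT X) x)) \<cdot>\<^bsub>base Z\<^esub> ?Q (far (carr P) (law X x))
          \<cdot>\<^bsub>base Z\<^esub> ?Q (sig P (fun_ob (comS X) x))
        = ?Q (fun_ar (comS Y) (sig P x)) \<cdot>\<^bsub>base Z\<^esub> ?Q (law Y (?P x))
          \<cdot>\<^bsub>base Z\<^esub> ?Q (fun_ar (comT Y) (gam P x))"
      using arg_cong[OF P.yang_baxter[OF x], of ?Q] by simp
    show "far (carr ?R) (delt (comT X) x) \<cdot>\<^bsub>base Z\<^esub> sig ?R x
        = sig ?R (fun_ob (comT X) x) \<cdot>\<^bsub>base Z\<^esub> fun_ar (comT Z) (sig ?R x)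
          \<cdot>\<^bsub>base Z\<^esub> delt (comT Z) (fob (carr ?R) x)"
      by (simp add: carr sig pasted[OF Q_sig_delt] Q.sig_delt pasted[OF sig_sig])
    show "far (carr ?R) (eps (comT X) x) \<cdot>\<^bsub>base Z\<^esub> sig ?R x = eps (comT Z) (fob (carr ?R) x)"
      by (simp add: carr sig pasted[OF Q_sig_eps] Q.sig_eps)
    show "delt (comS Z) (fob (carr ?R) x) \<cdot>\<^bsub>base Z\<^esub> gam ?R x
        = fun_ar (comS Z) (gam ?R x) \<cdot>\<^bsub>base Z\<^esub> gam ?R (fun_ob (comS X) x)
          \<cdot>\<^bsub>base Z\<^esub> far (carr ?R) (delt (comS X) x)"
      by (simp add: carr gam pasted[OF Q.gam_delt] Q_gam_delt pasted[OF gam_gam])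
    show "eps (comS Z) (fob (carr ?R) x) \<cdot>\<^bsub>base Z\<^esub> gam ?R x = far (carr ?R) (eps (comS X) x)"
      by (simp add: carr gam pasted[OF Q.gam_eps] Q_gam_eps)
    show "gam ?R (fun_ob (comT X) x) \<cdot>\<^bsub>base Z\<^esub> far (carr ?R) (law X x)
          \<cdot>\<^bsub>base Z\<^esub> sig ?R (fun_ob (comS X) x)
        = fun_ar (comS Z) (sig ?R x) \<cdot>\<^bsub>base Z\<^esub> law Z (fob (carr ?R) x)
          \<cdot>\<^bsub>base Z\<^esub> fun_ar (comT Z) (gam ?R x)"
      by (simp add: carr sig gam pasted3[OF Q_yang_baxter] sig_gam pasted[OF gam_sig]
          pasted3[OF Q.yang_baxter])
  qed (rule P.chi.distributive_law_axioms Q.tau.distributive_law_axioms)+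
qed
lemma carr_comp_cell [simp]: "carr (comp_cell X Z Q P) = ftor_comp (base X) (carr Q) (carr P)"
  by (simp add: comp_cell_def)

lemma carr_unit_cell [simp]: "carr (unit_cell X) = ftor_id (base X)"
  by (simp add: unit_cell_def)

text \<open>
  A composite structure map has two factors. The transformation \<open>Q\<alpha>\<close> passes the image of that of \<open>P\<close> by
  compatibility of \<open>\<alpha>\<close>, and that of \<open>Q\<close> by its naturality at \<open>\<alpha>\<close>; dually, \<open>\<beta>\<close> passes the former by
  its own naturality and the latter by its compatibility.
\<close>

lemma two_cell_hcomp:
  assumes "two_cell X Y P P' \<alpha>" "two_cell Y Z Q Q' \<beta>"
  shows "two_cell X Z (comp_cell X Z Q P) (comp_cell X Z Q' P')
    (hcomp (base X) (base Z) \<beta> (carr Q) \<alpha> (carr P'))"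
proof -
  interpret a: dist_two_cell "base X" "law X" "comT X" "comS X"
      "base Y" "law Y" "comT Y" "comS Y" P P' \<alpha> by fact
  interpret b: dist_two_cell "base Y" "law Y" "comT Y" "comS Y"
      "base Z" "law Z" "comT Z" "comS Z" Q Q' \<beta> by fact
  note pasted = b.P.tau.T.T.C.Cmp_pasted
  let ?\<theta> = "hcomp (base X) (base Z) \<beta> (carr Q) \<alpha> (carr P')"
  have "nat_trans (base X) (base Z) (carr (comp_cell X Z Q P)) (carr (comp_cell X Z Q' P')) ?\<theta>"
    using hcomp_nat_trans[OF a.nat_trans_axioms b.nat_trans_axioms] by simp
  moreover have "?\<theta> (fun_ob (comT X) x) \<cdot>\<^bsub>base Z\<^esub> sig (comp_cell X Z Q P) x
        = sig (comp_cell X Z Q' P') x \<cdot>\<^bsub>base Z\<^esub> fun_ar (comT Z) (?\<theta> x)"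
      (is ?sig)
    and "gam (comp_cell X Z Q' P') x \<cdot>\<^bsub>base Z\<^esub> ?\<theta> (fun_ob (comS X) x)
        = fun_ar (comS Z) (?\<theta> x) \<cdot>\<^bsub>base Z\<^esub> gam (comp_cell X Z Q P) x"
      (is ?gam)
    if x [simp]: "x \<in> Ob (base X)" for x
  proof -
    let ?x = "fob (carr P) x" and ?x' = "fob (carr P') x" and ?Q = "far (carr Q)"
    have Q_sig: "?Q (\<alpha> (fun_ob (comT X) x)) \<cdot>\<^bsub>base Z\<^esub> ?Q (sig P x)
        = ?Q (sig P' x) \<cdot>\<^bsub>base Z\<^esub> ?Q (fun_ar (comT Y) (\<alpha> x))"
      using arg_cong[OF a.sig_component[OF x], of ?Q] by simp
    have sig_nat: "?Q (fun_ar (comT Y) (\<alpha> x)) \<cdot>\<^bsub>base Z\<^esub> sig Q ?x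
        = sig Q ?x' \<cdot>\<^bsub>base Z\<^esub> fun_ar (comT Z) (?Q (\<alpha> x))"
      using b.P.sig.naturality[of "\<alpha> x"] by simp
    have beta_sig: "\<beta> (fob (carr P') (fun_ob (comT X) x)) \<cdot>\<^bsub>base Z\<^esub> ?Q (sig P' x)
        = far (carr Q') (sig P' x) \<cdot>\<^bsub>base Z\<^esub> \<beta> (fun_ob (comT Y) ?x')"
      using b.naturality[of "sig P' x"] by simp
    show ?sig
      by (simp add: comp_cell_def pasted[OF Q_sig] sig_nat pasted[OF beta_sig]
          pasted[OF b.sig_component])
    have Q_gam: "?Q (gam P' x) \<cdot>\<^bsub>base Z\<^esub> ?Q (\<alpha> (fun_ob (comS X) x))
        = ?Q (fun_ar (comS Y) (\<alpha> x)) \<cdot>\<^bsub>base Z\<^esub> ?Q (gam P x)"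
      using arg_cong[OF a.gam_component[OF x], of ?Q] by simp
    have gam_nat: "gam Q ?x' \<cdot>\<^bsub>base Z\<^esub> ?Q (fun_ar (comS Y) (\<alpha> x))
        = fun_ar (comS Z) (?Q (\<alpha> x)) \<cdot>\<^bsub>base Z\<^esub> gam Q ?x"
      using b.P.gam.naturality[of "\<alpha> x"] by simp
    have beta_gam: "far (carr Q') (gam P' x) \<cdot>\<^bsub>base Z\<^esub> \<beta> (fob (carr P') (fun_ob (comS X) x))
        = \<beta> (fun_ob (comS Y) ?x') \<cdot>\<^bsub>base Z\<^esub> ?Q (gam P' x)"
      using b.naturality[of "gam P' x"] by simp
    show ?gam
      by (simp add: comp_cell_def pasted[OF beta_gam] Q_gam pasted[OF b.gam_component]
          pasted[OF gam_nat])
  qed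
  ultimately show ?thesis
    using assms unfolding two_cell_iff is_two_cell_def by (blast intro: comp_one_cell)
qed

lemma comp_cell_unit_left:
  assumes "is_one_cell X Y P"
  shows "comp_cell X Y (unit_cell Y) P = P"
proof -
  interpret P: dist_one_cell "base X" "law X" "comT X" "comS X"
      "base Y" "law Y" "comT Y" "comS Y" P
    using assms by (simp add: is_one_cell_def)
  show ?thesis
    by (intro one_cell.equality extensionalityI[of _ "Ob (base X)"])
      (auto simp: comp_cell_def unit_cell_def P.P.ftor_comp_id_left)
qed

lemma comp_cell_unit_right:
  assumes "is_one_cell X Y P"
  shows "comp_cell X Y P (unit_cell X) = P"
proof -
  interpret P: dist_one_cell "base X" "law X" "comT X" "comS X"
      "base Y" "law Y" "comT Y" "comS Y" P
    using assms by (simp add: is_one_cell_def)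
  show ?thesis
    by (intro one_cell.equality extensionalityI[of _ "Ob (base X)"])
      (auto simp: comp_cell_def unit_cell_def P.P.ftor_comp_id_right)
qed

lemma comp_cell_assoc:
  assumes "is_one_cell W X P" "is_one_cell X Y Q" "is_one_cell Y Z R"
  shows "comp_cell W Z (comp_cell X Z R Q) P = comp_cell W Z R (comp_cell W Y Q P)"
proof -
  interpret P: dist_one_cell "base W" "law W" "comT W" "comS W"
      "base X" "law X" "comT X" "comS X" P
    using assms by (simp add: is_one_cell_def)
  interpret Q: dist_one_cell "base X" "law X" "comT X" "comS X"
      "base Y" "law Y" "comT Y" "comS Y" Q
    using assms by (simp add: is_one_cell_def)
  interpret R: dist_one_cell "base Y" "law Y" "comT Y" "comS Y"
      "base Z" "law Z" "comT Z" "comS Z" R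
    using assms by (simp add: is_one_cell_def)
  show ?thesis
    by (intro one_cell.equality extensionalityI[of _ "Ob (base W)"])
      (auto simp: comp_cell_def P.P.ftor_comp_assoc)
qed

lemma dist_hcomp_simps [simp]:
  "is_one_cell Y Z Q \<Longrightarrow> is_one_cell X Y P
    \<Longrightarrow> fob (dist_hcomp X Y Z) (Q, P) = comp_cell X Z Q P"
  "two_cell Y Z (src v) (tgt v) (body v) \<Longrightarrow> two_cell X Y (src u) (tgt u) (body u)
    \<Longrightarrow> far (dist_hcomp X Y Z) (v, u) =
      \<lparr>src = comp_cell X Z (src v) (src u),
       tgt = comp_cell X Z (tgt v) (tgt u),
       body = hcomp (base X) (base Z) (body v) (carr (src v)) (body u) (carr (tgt u))\<rparr>"
  by (simp_all add: dist_hcomp_def)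

lemma dist_hcomp_functor:
  "cat_functor (prod_cat (dist_hom Y Z) (dist_hom X Y)) (dist_hom X Z) (dist_hcomp X Y Z)"
proof (intro cat_functor.intro prod_cat_category dist_hom_category cat_functor_axioms.intro)
  show "fob (dist_hcomp X Y Z)
      \<in> Ob (prod_cat (dist_hom Y Z) (dist_hom X Y)) \<rightarrow>\<^sub>E Ob (dist_hom X Z)"
    by (auto simp: dist_hcomp_def prod_cat_def comp_one_cell)
  show "far (dist_hcomp X Y Z)
      \<in> Ar (prod_cat (dist_hom Y Z) (dist_hom X Y)) \<rightarrow>\<^sub>E Ar (dist_hom X Z)"
    by (auto simp: dist_hcomp_def prod_cat_def two_cell_hcomp)
qed (auto simp: prod_cat_def two_cell_ends two_cell_idt two_cell_vcomp
    hcomp_idt one_cell_functor intro!: interchange two_cell_nat_trans)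

lemma Dist_simps [simp]:
  "X \<in> Ob2 Dist \<longleftrightarrow> is_zero_cell X" "Hom Dist = dist_hom" "Unit Dist = unit_cell"
  "HComp Dist = dist_hcomp"
  by (simp_all add: Dist_def)

lemma Dist_two_category: "two_category Dist"
proof (rule two_category.intro, goal_cases)
  case (5 A B C D w v u)
  then show ?case
    using hcomp_assoc[OF two_cell_nat_trans two_cell_nat_trans two_cell_nat_trans,
        of A B "src u" "tgt u" "body u" C "src v" "tgt v" "body v"]
    by (simp add: two_cell_hcomp
        comp_cell_assoc[OF two_cell_ends(1) two_cell_ends(1) two_cell_ends(1)]
        comp_cell_assoc[OF two_cell_ends(2) two_cell_ends(2) two_cell_ends(2)])
next
  case (7 A B u)
  then show ?case
    using nat_trans.hcomp_unit_left[OF two_cell_nat_trans, of A B "src u" "tgt u" "body u"]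
      two_cell_idt[OF unit_one_cell, of B]
    by (simp add: comp_cell_unit_left two_cell_ends)
next
  case (9 A B u)
  then show ?case
    using nat_trans.hcomp_unit_right[OF two_cell_nat_trans, of A B "src u" "tgt u" "body u"]
      two_cell_idt[OF unit_one_cell, of A]
    by (simp add: comp_cell_unit_right two_cell_ends)
qed (simp_all add: dist_hom_category dist_hcomp_functor unit_one_cell comp_one_cell
    comp_cell_assoc comp_cell_unit_left comp_cell_unit_right)

section \<open>The category of coalgebras\<close>

locale coalgebra_morphism =
  M: chi_coalgebra B \<chi> T S M X \<rho> + N: chi_coalgebra B \<chi> T S N Y \<rho>' +
  F: cat_functor X Y F + nat_trans X B M "ftor_comp X N F" \<phi>
  for B :: "('o, 'a) cat" and \<chi> T S and M :: "('x, 'y, 'o, 'a) ftor" and X \<rho>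
    and N :: "('x, 'y, 'o, 'a) ftor" and Y \<rho>' F \<phi> +
  assumes rho_component: "x \<in> Ob X \<Longrightarrow>
      fun_ar S (\<phi> x) \<cdot>\<^bsub>B\<^esub> \<rho> x = \<rho>' (fob F x) \<cdot>\<^bsub>B\<^esub> fun_ar T (\<phi> x)"

abbreviation coalg_mor ::
  "('o, 'a) zero_cell \<Rightarrow> ('x, 'y, 'o, 'a) coalg \<Rightarrow> ('x, 'y, 'o, 'a) coalg
    \<Rightarrow> ('x, 'y, 'x, 'y) ftor \<Rightarrow> ('x \<Rightarrow> 'a) \<Rightarrow> bool"
where
  "coalg_mor Z m n \<equiv> coalgebra_morphism (base Z) (law Z) (comT Z) (comS Z)
    (cfun m) (cdom m) (crho m) (cfun n) (cdom n) (crho n)"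

lemma coalg_mor_iff:
  "coalg_mor Z m n F \<phi> \<longleftrightarrow> is_coalg Z m \<and> is_coalg Z n \<and> is_coalg_mor Z m n (F, \<phi>)"
  by (auto simp: coalgebra_morphism_def coalgebra_morphism_axioms_def is_coalg_def
      is_coalg_mor_def)

lemma coalg_cat_simps [simp]:
  "m \<in> Ob (coalg_cat Z) \<longleftrightarrow> is_coalg Z m"
  "u \<in> Ar (coalg_cat Z) \<longleftrightarrow> coalg_mor Z (src u) (tgt u) (fst (body u)) (snd (body u))"
  "Dom (coalg_cat Z) = src" "Cod (coalg_cat Z) = tgt"
  "Idn (coalg_cat Z) m
    = \<lparr>src = m, tgt = m, body = (ftor_id (cdom m), idt (cdom m) (base Z) (cfun m))\<rparr>"
  "Cmp (coalg_cat Z) v u = \<lparr>src = src u, tgt = tgt v,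
    body = (ftor_comp (cdom (src u)) (fst (body v)) (fst (body u)),
      vcomp (cdom (src u)) (base Z)
        (whisker_r (cdom (src u)) (snd (body v)) (fst (body u))) (snd (body u)))\<rparr>"
  unfolding coalg_mor_iff by (simp_all add: coalg_cat_def Let_def case_prod_beta)

lemma coalg_mor_ends:
  "coalg_mor Z m n F \<phi> \<Longrightarrow> is_coalg Z m" "coalg_mor Z m n F \<phi> \<Longrightarrow> is_coalg Z n"
  by (simp_all add: coalg_mor_iff)

lemma coalg_mor_functor: "coalg_mor Z m n F \<phi> \<Longrightarrow> cat_functor (cdom m) (cdom n) F"
  by (simp add: coalgebra_morphism_def)

lemma coalg_mor_nat_trans:
  "coalg_mor Z m n F \<phi>
    \<Longrightarrow> nat_trans (cdom m) (base Z) (cfun m) (ftor_comp (cdom m) (cfun n) F) \<phi>"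
  by (simp add: coalgebra_morphism_def)

lemma coalg_functor: "is_coalg Z m \<Longrightarrow> cat_functor (cdom m) (base Z) (cfun m)"
  by (simp add: is_coalg_def chi_coalgebra_def)

lemma coalg_mor_id:
  assumes "is_coalg Z m"
  shows "coalg_mor Z m m (ftor_id (cdom m)) (idt (cdom m) (base Z) (cfun m))"
proof -
  interpret m: chi_coalgebra "base Z" "law Z" "comT Z" "comS Z" "cfun m" "cdom m" "crho m"
    using assms by (simp add: is_coalg_def)
  show ?thesis
    by (intro coalgebra_morphism.intro coalgebra_morphism_axioms.intro)
      (simp_all add: m.M.ftor_comp_id_right m.M.idt_nat_trans m.chi_coalgebra_axioms
        m.M.C.ftor_id_functor)
qed

lemma coalg_mor_comp:
  assumes "coalg_mor Z l m F \<phi>" "coalg_mor Z m n F' \<phi>'"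
  shows "coalg_mor Z l n (ftor_comp (cdom l) F' F)
    (vcomp (cdom l) (base Z) (whisker_r (cdom l) \<phi>' F) \<phi>)"
proof -
  interpret u: coalgebra_morphism "base Z" "law Z" "comT Z" "comS Z"
      "cfun l" "cdom l" "crho l" "cfun m" "cdom m" "crho m" F \<phi> by fact
  interpret v: coalgebra_morphism "base Z" "law Z" "comT Z" "comS Z"
      "cfun m" "cdom m" "crho m" "cfun n" "cdom n" "crho n" F' \<phi>' by fact
  note pasted = u.M.chi.T.T.C.Cmp_pasted
  show ?thesis
  proof (intro coalgebra_morphism.intro coalgebra_morphism_axioms.intro)
    show "nat_trans (cdom l) (base Z) (cfun l)
        (ftor_comp (cdom l) (cfun n) (ftor_comp (cdom l) F' F))
        (vcomp (cdom l) (base Z) (whisker_r (cdom l) \<phi>' F) \<phi>)"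
      using vcomp_nat_trans[OF u.nat_trans_axioms
          whisker_r_nat_trans[OF u.F.cat_functor_axioms v.nat_trans_axioms]]
      by (simp add: u.F.ftor_comp_assoc)
  qed (auto intro: u.M.chi_coalgebra_axioms v.N.chi_coalgebra_axioms
      ftor_comp_functor u.F.cat_functor_axioms v.F.cat_functor_axioms
      simp: u.rho_component pasted[OF v.rho_component])
qed

text \<open>
  The associativity of the second components \<open>\<phi>''F'F \<circ> \<phi>'F \<circ> \<phi>\<close> of composable morphisms of
  coalgebras.
\<close>

lemma whiskered_vcomp_assoc:
  assumes "nat_trans X B M (ftor_comp X M' F) \<phi>" "cat_functor X X' F"
    and "nat_trans X' B M' (ftor_comp X' M'' F') \<phi>'" "cat_functor X' X'' F'"
    and "nat_trans X'' B M'' N \<phi>''"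
  shows "vcomp X B (whisker_r X (vcomp X' B (whisker_r X' \<phi>'' F') \<phi>') F) \<phi>
    = vcomp X B (whisker_r X \<phi>'' (ftor_comp X F' F)) (vcomp X B (whisker_r X \<phi>' F) \<phi>)"
proof -
  interpret p: nat_trans X B M "ftor_comp X M' F" \<phi> by fact
  interpret F: cat_functor X X' F by fact
  interpret p': nat_trans X' B M' "ftor_comp X' M'' F'" \<phi>' by fact
  interpret F': cat_functor X' X'' F' by fact
  interpret p'': nat_trans X'' B M'' N \<phi>'' by fact
  show ?thesis by (rule extensionalityI[of _ "Ob X"]) auto
qed

lemma coalg_cat_category: "category (coalg_cat Z)"
proof
  fix w v u
  assume "w \<in> Ar (coalg_cat Z)" "v \<in> Ar (coalg_cat Z)" "u \<in> Ar (coalg_cat Z)"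
    "Dom (coalg_cat Z) w = Cod (coalg_cat Z) v" "Dom (coalg_cat Z) v = Cod (coalg_cat Z) u"
  then show "Cmp (coalg_cat Z) (Cmp (coalg_cat Z) w v) u
      = Cmp (coalg_cat Z) w (Cmp (coalg_cat Z) v u)"
    using whiskered_vcomp_assoc[OF coalg_mor_nat_trans coalg_mor_functor coalg_mor_nat_trans
        coalg_mor_functor coalg_mor_nat_trans,
        of Z "src u" "src v" "fst (body u)" "snd (body u)" Z "snd (body u)" "src w"
        "fst (body v)" "snd (body v)" Z "snd (body v)" "tgt w" "fst (body w)" "snd (body w)"]
    by (auto intro: cat_functor.ftor_comp_assoc coalg_mor_functor)
next
  fix u assume u: "u \<in> Ar (coalg_cat Z)"
  then interpret u: coalgebra_morphism "base Z" "law Z" "comT Z" "comS Z"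
      "cfun (src u)" "cdom (src u)" "crho (src u)" "cfun (tgt u)" "cdom (tgt u)" "crho (tgt u)"
      "fst (body u)" "snd (body u)" by simp
  have r: "vcomp (cdom (src u)) (base Z)
      (whisker_r (cdom (src u)) (snd (body u)) (ftor_id (cdom (src u))))
      (idt (cdom (src u)) (base Z) (cfun (src u))) = snd (body u)"
    by (rule extensionalityI[of _ "Ob (cdom (src u))"]) auto
  have l: "vcomp (cdom (src u)) (base Z)
      (whisker_r (cdom (src u)) (idt (cdom (tgt u)) (base Z) (cfun (tgt u))) (fst (body u)))
      (snd (body u)) = snd (body u)"
    by (rule extensionalityI[of _ "Ob (cdom (src u))"]) auto
  show "Cmp (coalg_cat Z) u (Idn (coalg_cat Z) (Dom (coalg_cat Z) u)) = u"
    by (simp add: r u.F.ftor_comp_id_right)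
  show "Cmp (coalg_cat Z) (Idn (coalg_cat Z) (Cod (coalg_cat Z) u)) u = u"
    by (simp add: l u.F.ftor_comp_id_left)
qed (auto intro: coalg_mor_ends coalg_mor_id coalg_mor_comp)

section \<open>The action of a 1-cell on coalgebras\<close>

lemma act_ob_simps [simp]:
  "cfun (act_ob Y P m) = ftor_comp (cdom m) (carr P) (cfun m)"
  "cdom (act_ob Y P m) = cdom m"
  "x \<in> Ob (cdom m) \<Longrightarrow> crho (act_ob Y P m) x = gam P (fob (cfun m) x)
    \<cdot>\<^bsub>base Y\<^esub> far (carr P) (crho m x) \<cdot>\<^bsub>base Y\<^esub> sig P (fob (cfun m) x)"
  "U = Ob (cdom m) \<Longrightarrow> crho (act_ob Y P m) \<in> extensional U"
  by (simp_all add: act_ob_def Let_def)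

text \<open>
  The two outer copies of \<open>\<rho>\<close> produced by comultiplication slide past \<open>\<sigma>\<close> and \<open>\<gamma>\<close> by naturality, which
  exposes \<open>\<gamma>T \<circ> \<Sigma>\<chi> \<circ> \<sigma>S\<close> for the Yang-Baxter equation.
\<close>

lemma act_ob_coalg:
  assumes "is_one_cell Z Y P" "is_coalg Z m"
  shows "is_coalg Y (act_ob Y P m)"
proof -
  interpret P: dist_one_cell "base Z" "law Z" "comT Z" "comS Z"
      "base Y" "law Y" "comT Y" "comS Y" P
    using assms by (simp add: is_one_cell_def)
  interpret m: chi_coalgebra "base Z" "law Z" "comT Z" "comS Z" "cfun m" "cdom m" "crho m"
    using assms by (simp add: is_coalg_def)
  note pasted = P.tau.T.T.C.Cmp_pasted and pasted3 = P.tau.T.T.C.Cmp_pasted3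
  have rho_nat: "nat_trans (cdom m) (base Y)
      (ftor_comp (cdom m) (Fun (comT Y)) (cfun (act_ob Y P m)))
      (ftor_comp (cdom m) (Fun (comS Y)) (cfun (act_ob Y P m)))
      (crho (act_ob Y P m))"
    using vcomp_nat_trans[OF vcomp_nat_trans[OF
          whisker_r_nat_trans[OF m.M.cat_functor_axioms P.sig.nat_trans_axioms,
            unfolded m.M.ftor_comp_assoc]
          whisker_l_nat_trans[OF m.rho.nat_trans_axioms P.P.cat_functor_axioms]]
        whisker_r_nat_trans[OF m.M.cat_functor_axioms P.gam.nat_trans_axioms,
          unfolded m.M.ftor_comp_assoc]]
    by (simp add: act_ob_def Let_def)
  show ?thesis
    unfolding is_coalg_def
  proof (intro chi_coalgebra.intro chi_coalgebra_axioms.intro)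
    show "cat_functor (cdom (act_ob Y P m)) (base Y) (cfun (act_ob Y P m))"
      using ftor_comp_functor[OF m.M.cat_functor_axioms P.P.cat_functor_axioms] by simp
    show "nat_trans (cdom (act_ob Y P m)) (base Y)
      (ftor_comp (cdom (act_ob Y P m)) (Fun (comT Y)) (cfun (act_ob Y P m)))
      (ftor_comp (cdom (act_ob Y P m)) (Fun (comS Y)) (cfun (act_ob Y P m)))
      (crho (act_ob Y P m))"
      using rho_nat by simp
  next
    fix x assume "x \<in> Ob (cdom (act_ob Y P m))"
    then have x [simp]: "x \<in> Ob (cdom m)" by simp
    let ?M = "fob (cfun m) x" and ?P = "far (carr P)"
    have P_delt: "?P (delt (comS Z) ?M) \<cdot>\<^bsub>base Y\<^esub> ?P (crho m x)
        = ?P (fun_ar (comS Z) (crho m x)) \<cdot>\<^bsub>base Y\<^esub> ?P (law Z ?M)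
          \<cdot>\<^bsub>base Y\<^esub> ?P (fun_ar (comT Z) (crho m x)) \<cdot>\<^bsub>base Y\<^esub> ?P (delt (comT Z) ?M)"
      using arg_cong[OF m.delt_rho[OF x], of ?P] by simp
    have P_eps: "?P (eps (comS Z) ?M) \<cdot>\<^bsub>base Y\<^esub> ?P (crho m x) = ?P (eps (comT Z) ?M)"
      using arg_cong[OF m.eps_rho[OF x], of ?P] by simp
    have sig_rho: "?P (fun_ar (comT Z) (crho m x)) \<cdot>\<^bsub>base Y\<^esub> sig P (fun_ob (comT Z) ?M)
        = sig P (fun_ob (comS Z) ?M) \<cdot>\<^bsub>base Y\<^esub> fun_ar (comT Y) (?P (crho m x))"
      using P.sig.naturality[of "crho m x"] by simp
    have gam_rho: "gam P (fun_ob (comS Z) ?M) \<cdot>\<^bsub>base Y\<^esub> ?P (fun_ar (comS Z) (crho m x))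
        = fun_ar (comS Y) (?P (crho m x)) \<cdot>\<^bsub>base Y\<^esub> gam P (fun_ob (comT Z) ?M)"
      using P.gam.naturality[of "crho m x"] by simp
    show "delt (comS Y) (fob (cfun (act_ob Y P m)) x) \<cdot>\<^bsub>base Y\<^esub> crho (act_ob Y P m) x
        = fun_ar (comS Y) (crho (act_ob Y P m) x)
          \<cdot>\<^bsub>base Y\<^esub> law Y (fob (cfun (act_ob Y P m)) x)
          \<cdot>\<^bsub>base Y\<^esub> fun_ar (comT Y) (crho (act_ob Y P m) x)
          \<cdot>\<^bsub>base Y\<^esub> delt (comT Y) (fob (cfun (act_ob Y P m)) x)"
      by (simp add: pasted[OF P.gam_delt] pasted[OF P_delt] P.sig_delt pasted[OF sig_rho]
          pasted[OF gam_rho] pasted3[OF P.yang_baxter])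
    show "eps (comS Y) (fob (cfun (act_ob Y P m)) x) \<cdot>\<^bsub>base Y\<^esub> crho (act_ob Y P m) x
        = eps (comT Y) (fob (cfun (act_ob Y P m)) x)"
      by (simp add: pasted[OF P.gam_eps] pasted[OF P_eps] P.sig_eps)
  qed (rule P.tau.distributive_law_axioms)
qed

text \<open>
  The three factors \<open>\<gamma>M\<close>, \<open>\<Sigma>\<rho>\<close> and \<open>\<sigma>M\<close> are passed in turn: by \<open>\<Sigma>\<phi>\<close> because \<open>\<gamma>\<close> and \<open>\<sigma>\<close> are natural and
  \<open>\<phi>\<close> is compatible with \<open>\<rho>\<close>, then by \<open>\<alpha>\<close> because it is a 2-cell and natural at the components of
  the structure map of the target.
\<close>

lemma act_mor:
  assumes "two_cell Z Y P P' \<alpha>" "coalg_mor Z m n F \<phi>"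
  shows "coalg_mor Y (act_ob Y P m) (act_ob Y P' n) F
    (hcomp (cdom m) (base Y) \<alpha> (carr P) \<phi> (ftor_comp (cdom m) (cfun n) F))"
proof -
  interpret a: dist_two_cell "base Z" "law Z" "comT Z" "comS Z"
      "base Y" "law Y" "comT Y" "comS Y" P P' \<alpha> by fact
  interpret u: coalgebra_morphism "base Z" "law Z" "comT Z" "comS Z"
      "cfun m" "cdom m" "crho m" "cfun n" "cdom n" "crho n" F \<phi> by fact
  have coalg: "is_coalg Y (act_ob Y P m)" "is_coalg Y (act_ob Y P' n)"
    using assms by (auto intro: act_ob_coalg two_cell_ends coalg_mor_ends)
  note pasted = a.P.tau.T.T.C.Cmp_pasted
  show ?thesis
  proof (intro coalgebra_morphism.intro coalgebra_morphism_axioms.intro)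
    show "nat_trans (cdom (act_ob Y P m)) (base Y) (cfun (act_ob Y P m))
        (ftor_comp (cdom (act_ob Y P m)) (cfun (act_ob Y P' n)) F)
        (hcomp (cdom m) (base Y) \<alpha> (carr P) \<phi> (ftor_comp (cdom m) (cfun n) F))"
      using hcomp_nat_trans[OF u.nat_trans_axioms a.nat_trans_axioms]
      by (simp add: u.F.ftor_comp_assoc)
  next
    fix x assume "x \<in> Ob (cdom (act_ob Y P m))"
    then have x [simp]: "x \<in> Ob (cdom m)" by simp
    let ?M = "fob (cfun m) x" and ?N = "fob (cfun n) (fob F x)" and ?P = "far (carr P)"
      and ?\<rho> = "crho n (fob F x)"
    have gam_phi: "fun_ar (comS Y) (?P (\<phi> x)) \<cdot>\<^bsub>base Y\<^esub> gam P ?M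
        = gam P ?N \<cdot>\<^bsub>base Y\<^esub> ?P (fun_ar (comS Z) (\<phi> x))"
      using a.P.gam.naturality[of "\<phi> x"] by simp
    have P_phi: "?P (fun_ar (comS Z) (\<phi> x)) \<cdot>\<^bsub>base Y\<^esub> ?P (crho m x)
        = ?P ?\<rho> \<cdot>\<^bsub>base Y\<^esub> ?P (fun_ar (comT Z) (\<phi> x))"
      using arg_cong[OF u.rho_component[OF x], of ?P] by simp
    have sig_phi: "?P (fun_ar (comT Z) (\<phi> x)) \<cdot>\<^bsub>base Y\<^esub> sig P ?M
        = sig P ?N \<cdot>\<^bsub>base Y\<^esub> fun_ar (comT Y) (?P (\<phi> x))"
      using a.P.sig.naturality[of "\<phi> x"] by simp
    have alpha_rho: "\<alpha> (fun_ob (comS Z) ?N) \<cdot>\<^bsub>base Y\<^esub> ?P ?\<rho>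
        = far (carr P') ?\<rho> \<cdot>\<^bsub>base Y\<^esub> \<alpha> (fun_ob (comT Z) ?N)"
      using a.naturality[of ?\<rho>] by simp
    show "fun_ar (comS Y)
          (hcomp (cdom m) (base Y) \<alpha> (carr P) \<phi> (ftor_comp (cdom m) (cfun n) F) x)
          \<cdot>\<^bsub>base Y\<^esub> crho (act_ob Y P m) x
        = crho (act_ob Y P' n) (fob F x) \<cdot>\<^bsub>base Y\<^esub> fun_ar (comT Y)
          (hcomp (cdom m) (base Y) \<alpha> (carr P) \<phi> (ftor_comp (cdom m) (cfun n) F) x)"
      by (simp add: pasted[OF gam_phi] pasted[OF P_phi] sig_phi
          pasted[OF a.gam_component[symmetric]] pasted[OF alpha_rho] pasted[OF a.sig_component])
  qed (use coalg u.F.cat_functor_axioms in \<open>simp_all add: is_coalg_def\<close>)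
qed

section \<open>The module of coalgebras\<close>

lemma act_ob_unit:
  assumes "is_coalg Z m"
  shows "act_ob Z (unit_cell Z) m = m"
proof -
  interpret m: chi_coalgebra "base Z" "law Z" "comT Z" "comS Z" "cfun m" "cdom m" "crho m"
    using assms by (simp add: is_coalg_def)
  show ?thesis
    by (intro coalg.equality extensionalityI[of _ "Ob (cdom m)"])
      (auto simp: unit_cell_def m.M.ftor_comp_id_left)
qed

lemma act_ob_comp:
  assumes "is_one_cell X Y P" "is_one_cell Y Z Q" "is_coalg X m"
  shows "act_ob Z (comp_cell X Z Q P) m = act_ob Z Q (act_ob Y P m)"
proof -
  interpret P: dist_one_cell "base X" "law X" "comT X" "comS X"
      "base Y" "law Y" "comT Y" "comS Y" P
    using assms by (simp add: is_one_cell_def)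
  interpret Q: dist_one_cell "base Y" "law Y" "comT Y" "comS Y"
      "base Z" "law Z" "comT Z" "comS Z" Q
    using assms by (simp add: is_one_cell_def)
  interpret m: chi_coalgebra "base X" "law X" "comT X" "comS X" "cfun m" "cdom m" "crho m"
    using assms by (simp add: is_coalg_def)
  show ?thesis
    by (intro coalg.equality extensionalityI[of _ "Ob (cdom m)"])
      (auto simp: comp_cell_def m.M.ftor_comp_assoc)
qed

lemma coalg_act_simps [simp]:
  "is_one_cell Z Y P \<Longrightarrow> is_coalg Z m \<Longrightarrow> fob (coalg_act Z Y) (P, m) = act_ob Y P m"
  "two_cell Z Y (src v) (tgt v) (body v)
    \<Longrightarrow> coalg_mor Z (src u) (tgt u) (fst (body u)) (snd (body u))
    \<Longrightarrow> far (coalg_act Z Y) (v, u) =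
      \<lparr>src = act_ob Y (src v) (src u),
       tgt = act_ob Y (tgt v) (tgt u),
       body = (fst (body u), hcomp (cdom (src u)) (base Y) (body v) (carr (src v))
         (snd (body u)) (ftor_comp (cdom (src u)) (cfun (tgt u)) (fst (body u))))\<rparr>"
  by (simp_all add: coalg_act_def act_ar_def Let_def case_prod_beta)

text \<open>
  Functoriality of the action on morphisms: the interchange law for \<open>\<phi>\<close> and \<open>\<phi>'F\<close>, followed by moving
  the whiskering with \<open>F\<close> out of the horizontal composite \<open>\<beta>(\<phi>'F) = (\<beta>\<phi>')F\<close>.
\<close>

lemma hcomp_whiskered_vcomp:
  assumes "nat_trans X B M (ftor_comp X M' F) \<phi>" "cat_functor X X' F"
    and "nat_trans X' B M' (ftor_comp X' M'' F') \<phi>'" "cat_functor X' X'' F'"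
    and "nat_trans B D H K \<alpha>" "nat_trans B D K L \<beta>"
  shows "hcomp X D (vcomp B D \<beta> \<alpha>) H (vcomp X B (whisker_r X \<phi>' F) \<phi>)
      (ftor_comp X M'' (ftor_comp X F' F))
    = vcomp X D (whisker_r X (hcomp X' D \<beta> K \<phi>' (ftor_comp X' M'' F')) F)
      (hcomp X D \<alpha> H \<phi> (ftor_comp X M' F))"
proof -
  interpret F: cat_functor X X' F by fact
  have "hcomp X D (vcomp B D \<beta> \<alpha>) H (vcomp X B (whisker_r X \<phi>' F) \<phi>)
      (ftor_comp X M'' (ftor_comp X F' F))
    = vcomp X D (hcomp X D \<beta> K (whisker_r X \<phi>' F) (ftor_comp X M'' (ftor_comp X F' F)))
      (hcomp X D \<alpha> H \<phi> (ftor_comp X M' F))"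
    by (rule interchange[OF assms(1)
        whisker_r_nat_trans[OF assms(2,3), unfolded F.ftor_comp_assoc] assms(5,6)])
  also have "hcomp X D \<beta> K (whisker_r X \<phi>' F) (ftor_comp X M'' (ftor_comp X F' F))
      = whisker_r X (hcomp X' D \<beta> K \<phi>' (ftor_comp X' M'' F')) F"
    by (rule extensionalityI[of _ "Ob X"]) auto
  finally show ?thesis .
qed

lemma coalg_act_functor:
  "cat_functor (prod_cat (dist_hom Z Y) (coalg_cat Z)) (coalg_cat Y) (coalg_act Z Y)"
proof (intro cat_functor.intro prod_cat_category dist_hom_category coalg_cat_category
    cat_functor_axioms.intro)
  show "fob (coalg_act Z Y) \<in> Ob (prod_cat (dist_hom Z Y) (coalg_cat Z)) \<rightarrow>\<^sub>E Ob (coalg_cat Y)"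
    by (auto simp: coalg_act_def prod_cat_def act_ob_coalg)
  show "far (coalg_act Z Y) \<in> Ar (prod_cat (dist_hom Z Y) (coalg_cat Z)) \<rightarrow>\<^sub>E Ar (coalg_cat Y)"
    by (auto simp: coalg_act_def prod_cat_def act_ar_def Let_def case_prod_beta act_mor
        simp del: act_ob_simps)
next
  fix x
  assume "x \<in> Ob (prod_cat (dist_hom Z Y) (coalg_cat Z))"
  then obtain P m where x: "x = (P, m)" and P: "is_one_cell Z Y P" and m: "is_coalg Z m"
    by (auto simp: prod_cat_def)
  interpret m: cat_functor "cdom m" "base Z" "cfun m" by (rule coalg_functor[OF m])
  show "far (coalg_act Z Y) (Idn (prod_cat (dist_hom Z Y) (coalg_cat Z)) x)
      = Idn (coalg_cat Y) (fob (coalg_act Z Y) x)"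
    using P m hcomp_idt[OF coalg_functor[OF m] one_cell_functor[OF P]]
    by (simp add: x prod_cat_def two_cell_idt coalg_mor_id m.ftor_comp_id_right)
next
  fix g f
  assume g: "g \<in> Ar (prod_cat (dist_hom Z Y) (coalg_cat Z))"
    and f: "f \<in> Ar (prod_cat (dist_hom Z Y) (coalg_cat Z))"
    and gf: "Dom (prod_cat (dist_hom Z Y) (coalg_cat Z)) g
      = Cod (prod_cat (dist_hom Z Y) (coalg_cat Z)) f"
  obtain v u v' u' where vu: "f = (v, u)" "g = (v', u')"
    by (cases f, cases g) auto
  from g f gf have cells: "two_cell Z Y (src v) (src v') (body v)"
      "two_cell Z Y (src v') (tgt v') (body v')" "tgt v = src v'"
    and mors: "coalg_mor Z (src u) (src u') (fst (body u)) (snd (body u))"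
      "coalg_mor Z (src u') (tgt u') (fst (body u')) (snd (body u'))" "tgt u = src u'"
    by (auto simp: vu prod_cat_def)
  show "far (coalg_act Z Y) (Cmp (prod_cat (dist_hom Z Y) (coalg_cat Z)) g f)
      = Cmp (coalg_cat Y) (far (coalg_act Z Y) g) (far (coalg_act Z Y) f)"
    using cells mors two_cell_vcomp[OF cells(1,2)] coalg_mor_comp[OF mors(1,2)]
      hcomp_whiskered_vcomp[OF coalg_mor_nat_trans[OF mors(1)] coalg_mor_functor[OF mors(1)]
        coalg_mor_nat_trans[OF mors(2)] coalg_mor_functor[OF mors(2)]
        two_cell_nat_trans[OF cells(1)] two_cell_nat_trans[OF cells(2)]]
    by (simp add: vu prod_cat_def)
qed (auto simp: prod_cat_def two_cell_ends coalg_mor_ends)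

theorem theorem3p2p9:
  shows "left_module
    (Dist :: (('o, 'a) zero_cell, ('o, 'a) one_cell, (('o, 'a) one_cell, 'o \<Rightarrow> 'a) arrow) two_cat)
    (coalg_cat :: ('o, 'a) zero_cell \<Rightarrow> (('x, 'y, 'o, 'a) coalg, ('x, 'y, 'o, 'a) coalg_mor) cat)
    coalg_act"
proof (intro left_module.intro Dist_two_category left_module_axioms.intro, goal_cases)
  case (4 A B C v u a)
  then have v: "two_cell B C (src v) (tgt v) (body v)"
    and u: "two_cell A B (src u) (tgt u) (body u)"
    and a: "coalg_mor A (src a) (tgt a) (fst (body a)) (snd (body a))"
    by simp_all
  interpret F: cat_functor "cdom (src a)" "cdom (tgt a)" "fst (body a)"
    by (rule coalg_mor_functor[OF a])
  show ?case
    using v u a two_cell_hcomp[OF u v] act_mor[OF u a]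
      hcomp_assoc[OF coalg_mor_nat_trans[OF a] two_cell_nat_trans[OF u] two_cell_nat_trans[OF v]]
      act_ob_comp[OF two_cell_ends(1)[OF u] two_cell_ends(1)[OF v] coalg_mor_ends(1)[OF a]]
      act_ob_comp[OF two_cell_ends(2)[OF u] two_cell_ends(2)[OF v] coalg_mor_ends(2)[OF a]]
    by (simp add: F.ftor_comp_assoc)
next
  case (6 A a)
  then have a: "coalg_mor A (src a) (tgt a) (fst (body a)) (snd (body a))"
    and A: "is_zero_cell A"
    by simp_all
  show ?case
    using a two_cell_idt[OF unit_one_cell[OF A]]
      nat_trans.hcomp_unit_left[OF coalg_mor_nat_trans[OF a]]
      act_ob_unit[OF coalg_mor_ends(1)[OF a]] act_ob_unit[OF coalg_mor_ends(2)[OF a]]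
    by simp
qed (simp_all add: coalg_cat_category coalg_act_functor unit_one_cell comp_one_cell
    act_ob_coalg act_ob_comp act_ob_unit)

end
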